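(* Let $(E)$ be a finite satisfiable set of experimental equations (for one qubit, in one variable). Then there exist an integer $k\ge1$ and a real $C>0$ such that for all $\varepsilon\ge0$, $(E)$ is $(\varepsilon,C\varepsilon^{1/k})$-robust.
   Context: A one-qubit density matrix is a positive semidefinite Hermitian $2\times2$ matrix of trace $1$. A one-qubit superoperator is a linear map on $\mathbb{C}^{2\times2}$; a superoperator is a PSO if it sends density matrices to density matrices; $\mathbf{G}$ is a CPSO if $\mathbf{G}\otimes\mathbf{I}_M$ is a PSO for every positive integer $M$, where $\mathbf{I}_M$ is the identity on $\mathbb{C}^{M\times M}$. $\mathrm{Pr}^0[\rho]=\langle0|\rho|0\rangle$. An experimental equation (one qubit, one variable) is an equation $\mathrm{Pr}^0[\mathbf{G}^k(|b\rangle\langle b|)]=r$ in the unknown one-qubit CPSO $\mathbf{G}$, where $k$ is a non-negative integer, $b\in\{0,1\}$ and $0\le r\le1$. $\mathbf{G}$ $\varepsilon$-satisfies it if $|\mathrm{Pr}^0[\mathbf{G}^k(|b\rangle\langle b|)]-r|\le\varepsilon$, and satisfies it if this holds with $\varepsilon=0$. $\mathbf{G}$ ($\varepsilon$-)satisfies a finite set $(E)$ of such equations if it ($\varepsilon$-)satisfies each one. $(E)$ is satisfiable if some CPSO satisfies it; $\mathcal{F}_{(E)}$ is the set of all one-qubit CPSOs satisfying $(E)$. $\|V\|_1=\mathrm{Tr}\sqrt{V^\dagger V}$, $\|\mathbf{G}\|_\infty=\sup\{\|\mathbf{G}(V)\|_1:\|V\|_1=1\}$ for a superoperator $\mathbf{G}$,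 and $\mathrm{dist}_\infty$ is the induced distance (distance to a set being the infimum). For $\varepsilon,\delta\ge0$, a finite satisfiable $(E)$ is $(\varepsilon,\delta)$-robust if every CPSO $\mathbf{G}$ that $\varepsilon$-satisfies $(E)$ has $\mathrm{dist}_\infty(\mathbf{G},\mathcal{F}_{(E)})\le\delta$. *)

theory Defs
  imports Complex_Main "Jordan_Normal_Form.Schur_Decomposition"
begin

section \<open>Matrices\<close>

definition mtrace :: "complex mat \<Rightarrow> complex" where
  "mtrace A = (\<Sum>i<dim_row A. A $$ (i, i))"

text \<open>The order on the complex numbers is the partial one, so \<open>0 \<le> z\<close> says that \<open>z\<close> is
  real and non-negative; the term \<open>(A *\<^sub>v v) \<bullet>c v\<close> is \<open>v\<^sup>* A v\<close>.\<close>

definition psd :: "nat \<Rightarrow> complex mat \<Rightarrow> bool" where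
  "psd n A \<longleftrightarrow> A \<in> carrier_mat n n \<and> mat_adjoint A = A \<and>
     (\<forall>v\<in>carrier_vec n. 0 \<le> (A *\<^sub>v v) \<bullet>c v)"

definition density :: "nat \<Rightarrow> complex mat \<Rightarrow> bool" where
  "density n \<rho> \<longleftrightarrow> psd n \<rho> \<and> mtrace \<rho> = 1"

text \<open>The description is proper whenever \<open>A\<close> is positive semidefinite, which is the only case in
  which it is used.\<close>

definition psd_sqrt :: "nat \<Rightarrow> complex mat \<Rightarrow> complex mat" where
  "psd_sqrt n A = (THE P. psd n P \<and> P * P = A)"

definition trace_norm :: "nat \<Rightarrow> complex mat \<Rightarrow> real" where
  "trace_norm n V = Re (mtrace (psd_sqrt n (mat_adjoint V * V)))"


section \<open>Superoperators\<close>

text \<open>A superoperator on \<open>n \<times> n\<close> matrices is a HOL function on all matrices of which only the values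
  on \<open>carrier_mat n n\<close> matter: every notion below depends on those values alone.\<close>

definition superoperator :: "nat \<Rightarrow> (complex mat \<Rightarrow> complex mat) \<Rightarrow> bool" where
  "superoperator n G \<longleftrightarrow>
     (\<forall>A\<in>carrier_mat n n. G A \<in> carrier_mat n n) \<and>
     (\<forall>A\<in>carrier_mat n n. \<forall>B\<in>carrier_mat n n. G (A + B) = G A + G B) \<and>
     (\<forall>c. \<forall>A\<in>carrier_mat n n. G (c \<cdot>\<^sub>m A) = c \<cdot>\<^sub>m G A)"

definition pso :: "nat \<Rightarrow> (complex mat \<Rightarrow> complex mat) \<Rightarrow> bool" where
  "pso n G \<longleftrightarrow> superoperator n G \<and> (\<forall>\<rho>. density n \<rho> \<longrightarrow> density n (G \<rho>))"

text \<open>The space of \<open>n \<times> n\<close> matrices tensored with that of \<open>M \<times> M\<close> matrices is identified with the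
  \<open>nM \<times> nM\<close> matrices by the Kronecker product, the index pair \<open>(i, a)\<close> being encoded as
  \<open>i * M + a\<close>. The map \<open>tensor_id n M G\<close> is \<open>G\<close> tensored with the identity on \<open>M \<times> M\<close> matrices:
  for fixed \<open>a\<close>, \<open>b\<close> it applies \<open>G\<close> to the \<open>n \<times> n\<close> matrix of the entries at
  \<open>((i, a), (j, b))\<close>. The two lemmas below show that it is the tensor product, since the Kronecker
  products span.\<close>

definition kronecker :: "complex mat \<Rightarrow> complex mat \<Rightarrow> complex mat" where
  "kronecker V W = mat (dim_row V * dim_row W) (dim_col V * dim_col W)
     (\<lambda>(r, s). V $$ (r div dim_row W, s div dim_col W) * W $$ (r mod dim_row W, s mod dim_col W))"

definition partial_block :: "nat \<Rightarrow> nat \<Rightarrow> nat \<Rightarrow> nat \<Rightarrow> complex mat \<Rightarrow> complex mat" where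
  "partial_block n M a b A = mat n n (\<lambda>(i, j). A $$ (i * M + a, j * M + b))"

definition tensor_id ::
  "nat \<Rightarrow> nat \<Rightarrow> (complex mat \<Rightarrow> complex mat) \<Rightarrow> complex mat \<Rightarrow> complex mat" where
  "tensor_id n M G A = mat (n * M) (n * M)
     (\<lambda>(r, s). G (partial_block n M (r mod M) (s mod M) A) $$ (r div M, s div M))"

definition cpso :: "nat \<Rightarrow> (complex mat \<Rightarrow> complex mat) \<Rightarrow> bool" where
  "cpso n G \<longleftrightarrow> superoperator n G \<and> (\<forall>M>0. pso (n * M) (tensor_id n M G))"

lemma pair_index_less: "i < n \<Longrightarrow> a < M \<Longrightarrow> i * M + a < n * (M::nat)"
proof -
  assume "i < n" "a < M"
  then have "i * M + a < (i + 1) * M" by simp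
  also have "\<dots> \<le> n * M" using \<open>i < n\<close> by (intro mult_right_mono) auto
  finally show ?thesis .
qed

lemma pair_index_bounds:
  assumes "r < n * (M::nat)"
  shows "r div M < n" "r mod M < M"
proof -
  have "M > 0" using assms by (cases M) auto
  then show "r div M < n" "r mod M < M" using assms by (auto simp: less_mult_imp_div_less)
qed

lemma tensor_id_kronecker:
  assumes "superoperator n G" "V \<in> carrier_mat n n" "W \<in> carrier_mat M M"
  shows "tensor_id n M G (kronecker V W) = kronecker (G V) W"
proof -
  have GV: "G V \<in> carrier_mat n n" using assms by (auto simp: superoperator_def)
  have block: "partial_block n M a b (kronecker V W) = W $$ (a, b) \<cdot>\<^sub>m V" if "a < M" "b < M" for a b
    using that assms(2,3) pair_index_less[of _ n _ M]
    by (intro eq_matI) (auto simp: partial_block_def kronecker_def)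
  show ?thesis
  proof (rule eq_matI)
    fix r s
    assume "r < dim_row (kronecker (G V) W)" "s < dim_col (kronecker (G V) W)"
    then have rs: "r < n * M" "s < n * M" using GV assms(3) by (auto simp: kronecker_def)
    note b = pair_index_bounds[OF rs(1)] pair_index_bounds[OF rs(2)]
    have "tensor_id n M G (kronecker V W) $$ (r, s)
        = G (W $$ (r mod M, s mod M) \<cdot>\<^sub>m V) $$ (r div M, s div M)"
      using rs b block by (simp add: tensor_id_def)
    also have "G (W $$ (r mod M, s mod M) \<cdot>\<^sub>m V) = W $$ (r mod M, s mod M) \<cdot>\<^sub>m G V"
      using assms(1,2) by (auto simp: superoperator_def)
    finally show "tensor_id n M G (kronecker V W) $$ (r, s) = kronecker (G V) W $$ (r, s)"
      using rs b GV assms(3) by (simp add: kronecker_def)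
  qed (use GV assms(3) in \<open>auto simp: kronecker_def tensor_id_def\<close>)
qed

lemma superoperator_tensor_id:
  assumes "superoperator n G"
  shows "superoperator (n * M) (tensor_id n M G)"
proof -
  have c: "partial_block n M a b A \<in> carrier_mat n n" for a b A
    by (simp add: partial_block_def)
  have Gc: "G (partial_block n M a b A) \<in> carrier_mat n n" for a b A
    using assms c by (auto simp: superoperator_def)
  have add: "partial_block n M a b (A + B) = partial_block n M a b A + partial_block n M a b B"
    if "a < M" "b < M" "A \<in> carrier_mat (n * M) (n * M)" "B \<in> carrier_mat (n * M) (n * M)"
    for a b A B
    using that pair_index_less[of _ n _ M] by (intro eq_matI) (auto simp: partial_block_def)
  have smult: "partial_block n M a b (x \<cdot>\<^sub>m A) = x \<cdot>\<^sub>m partial_block n M a b A"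
    if "a < M" "b < M" "A \<in> carrier_mat (n * M) (n * M)" for a b x A
    using that pair_index_less[of _ n _ M] by (intro eq_matI) (auto simp: partial_block_def)
  have Gadd: "G (partial_block n M a b A + partial_block n M a b B)
      = G (partial_block n M a b A) + G (partial_block n M a b B)" for a b A B
    using assms c by (auto simp: superoperator_def)
  have Gsmult: "G (x \<cdot>\<^sub>m partial_block n M a b A) = x \<cdot>\<^sub>m G (partial_block n M a b A)" for x a b A
    using assms c by (auto simp: superoperator_def)
  have dims: "dim_row (G (partial_block n M a b A)) = n" "dim_col (G (partial_block n M a b A)) = n"
    for a b A using Gc[of a b A] by auto
  show ?thesis
    unfolding superoperator_def
  proof (intro conjI ballI allI)
    fix A B :: "complex mat" assume "A \<in> carrier_mat (n * M) (n * M)" "B \<in> carrier_mat (n * M) (n * M)"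
    then show "tensor_id n M G (A + B) = tensor_id n M G A + tensor_id n M G B"
      by (intro eq_matI) (simp_all add: tensor_id_def add Gadd pair_index_bounds dims)
  next
    fix x and A :: "complex mat" assume "A \<in> carrier_mat (n * M) (n * M)"
    then show "tensor_id n M G (x \<cdot>\<^sub>m A) = x \<cdot>\<^sub>m tensor_id n M G A"
      by (intro eq_matI) (simp_all add: tensor_id_def smult Gsmult pair_index_bounds dims)
  qed (simp add: tensor_id_def)
qed


section \<open>Distance of one-qubit superoperators\<close>

definition op_norm :: "(complex mat \<Rightarrow> complex mat) \<Rightarrow> real" where
  "op_norm G = Sup {trace_norm 2 (G V) | V. V \<in> carrier_mat 2 2 \<and> trace_norm 2 V = 1}"

definition op_dist :: "(complex mat \<Rightarrow> complex mat) \<Rightarrow> (complex mat \<Rightarrow> complex mat) \<Rightarrow> real" where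
  "op_dist G H = op_norm (\<lambda>V. G V - H V)"

definition op_setdist :: "(complex mat \<Rightarrow> complex mat) \<Rightarrow> (complex mat \<Rightarrow> complex mat) set \<Rightarrow> real" where
  "op_setdist G F = Inf {op_dist G H | H. H \<in> F}"


section \<open>Experimental equations\<close>

definition ket_bra :: "nat \<Rightarrow> complex mat" where
  "ket_bra b = mat 2 2 (\<lambda>(i, j). if i = b \<and> j = b then 1 else 0)"

text \<open>The expectation is real for density matrices; \<open>Re\<close> only adjusts the type.\<close>

definition Pr0 :: "complex mat \<Rightarrow> real" where
  "Pr0 \<rho> = Re ((\<rho> *\<^sub>v unit_vec 2 0) \<bullet>c unit_vec 2 0)"

text \<open>\<open>Exp_Eq k b r\<close> stands for the equation \<open>Pr0 (G\<^sup>k (|b><b|)) = r\<close>.\<close>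

datatype exp_eq = Exp_Eq (eq_power: nat) (eq_input: nat) (eq_prob: real)

definition experimental_equation :: "exp_eq \<Rightarrow> bool" where
  "experimental_equation e \<longleftrightarrow> eq_input e \<in> {0, 1} \<and> 0 \<le> eq_prob e \<and> eq_prob e \<le> 1"

definition eps_satisfies :: "real \<Rightarrow> (complex mat \<Rightarrow> complex mat) \<Rightarrow> exp_eq set \<Rightarrow> bool" where
  "eps_satisfies \<epsilon> G E \<longleftrightarrow>
     (\<forall>e\<in>E. \<bar>Pr0 ((G ^^ eq_power e) (ket_bra (eq_input e))) - eq_prob e\<bar> \<le> \<epsilon>)"

definition solutions :: "exp_eq set \<Rightarrow> (complex mat \<Rightarrow> complex mat) set" where
  "solutions E = {G. cpso 2 G \<and> eps_satisfies 0 G E}"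

definition satisfiable :: "exp_eq set \<Rightarrow> bool" where
  "satisfiable E \<longleftrightarrow> (\<exists>G. cpso 2 G \<and> eps_satisfies 0 G E)"

definition robust :: "real \<Rightarrow> real \<Rightarrow> exp_eq set \<Rightarrow> bool" where
  "robust \<epsilon> \<delta> E \<longleftrightarrow>
     (\<forall>G. cpso 2 G \<and> eps_satisfies \<epsilon> G E \<longrightarrow> op_setdist G (solutions E) \<le> \<delta>)"

end

theory Submission
  imports Defs "HOL-Computational_Algebra.Polynomial"
begin

text \<open>By the Choi-Kraus representation the one-qubit CPSOs are the maps
  \<open>X \<mapsto> \<Sum>\<^sub>l A\<^sub>l X A\<^sub>l\<^sup>*\<close> with four Kraus operators subject to \<open>\<Sum>\<^sub>l A\<^sub>l\<^sup>* A\<^sub>l = 1\<close>. In the 32 real coordinates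
  of the Kraus operators the solution set is thus a bounded real algebraic set (no inequalities are
  needed), so the theorem is an instance of the Lojasiewicz inequality.

  That inequality is proved without quantifier elimination. Counterexamples \<open>x\<^sub>n\<close> with error \<open>e\<^sub>n\<close> for the
  constants \<open>k = C = n\<close> give a point \<open>x\<close> with infinitesimal error \<open>e\<close> over an ultrapower of the reals. The elements \<open>z\<close>
  with \<open>|z|\<^sup>k e \<le> 1\<close> for all \<open>k\<close> form a convex valuation ring; its maximal ideal consists of the
  elements with \<open>|z|\<^sup>k \<le> e\<close> for some \<open>k \<ge> 1\<close>. A maximal subfield of the valuation ring containing the
  reals maps onto the residue field, because simple roots of polynomials lift by the intermediate
  value theorem. Replacing the coordinates of \<open>x\<close> by their representatives \<open>y\<close> in this field makes the polynomials
  vanish exactly, while each coordinate changes by at most \<open>e\<^sup>1\<^sup>/\<^sup>k\<close>, a contradiction.\<close>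


section \<open>Coefficient fields of convex valuation rings\<close>

text \<open>The obstacle is the exponent: it depends on all equations jointly and nothing bounds it
  in advance. No exponent is ever computed. The ring is chosen so that being infinitesimal relative
  to it means exactly being bounded by some root of the error; it is the largest convex ring in
  which the error is not invertible. The gap between a small value and the value zero is closed by
  algebra alone: polynomial values at points of a subfield containing the coefficients stay in that
  subfield, and a subfield of the ring meets the maximal ideal only in zero. That a maximal subfield
  reaches every residue class rests on two cases. A residue transcendental over the subfield is
  reached by adjoining any element of its class. An algebraic one needs an exact root of its minimal
  polynomial; the root is simple because the characteristic is zero. The Kraus form serves twice:
  complete positivity becomes automatic, and the normalization bounds all coordinates, which puts
  them into the ring.\<close>

definition subfield_set :: "'a::field set \<Rightarrow> bool" where
  "subfield_set K \<longleftrightarrow> 1 \<in> K \<and> (\<forall>x\<in>K. \<forall>y\<in>K. x - y \<in> K \<and> x * y \<in> K) \<and> (\<forall>x\<in>K. inverse x \<in> K)"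

lemma subfield_setD:
  assumes "subfield_set K"
  shows "0 \<in> K" "1 \<in> K" "x \<in> K \<Longrightarrow> - x \<in> K" "x \<in> K \<Longrightarrow> y \<in> K \<Longrightarrow> x + y \<in> K"
    "x \<in> K \<Longrightarrow> y \<in> K \<Longrightarrow> x - y \<in> K" "x \<in> K \<Longrightarrow> y \<in> K \<Longrightarrow> x * y \<in> K"
    "x \<in> K \<Longrightarrow> inverse x \<in> K" "x \<in> K \<Longrightarrow> y \<in> K \<Longrightarrow> x / y \<in> K"
proof -
  show *: "1 \<in> K" "\<And>x y. x \<in> K \<Longrightarrow> y \<in> K \<Longrightarrow> x - y \<in> K"
    "\<And>x y. x \<in> K \<Longrightarrow> y \<in> K \<Longrightarrow> x * y \<in> K" "\<And>x. x \<in> K \<Longrightarrow> inverse x \<in> K"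
    using assms by (auto simp: subfield_set_def)
  show 0: "0 \<in> K" using *(2)[OF *(1,1)] by simp
  show m: "\<And>x. x \<in> K \<Longrightarrow> - x \<in> K" using *(2)[OF 0] by simp
  show "x \<in> K \<Longrightarrow> y \<in> K \<Longrightarrow> x + y \<in> K" using *(2)[OF _ m, of x y] by simp
  show "x \<in> K \<Longrightarrow> y \<in> K \<Longrightarrow> x / y \<in> K" using * by (simp add: divide_inverse)
qed

definition coeffs_in :: "'a::comm_ring_1 set \<Rightarrow> 'a poly \<Rightarrow> bool" where
  "coeffs_in K p \<longleftrightarrow> (\<forall>i. coeff p i \<in> K)"

lemma subfield_set_sum:
  assumes "subfield_set K" "\<And>i. i \<in> I \<Longrightarrow> f i \<in> K"
  shows "sum f I \<in> K"
  using assms(2) by (induction I rule: infinite_finite_induct) (auto simp: subfield_setD[OF assms(1)])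

lemma coeffs_in_ops:
  assumes K: "subfield_set K" and p: "coeffs_in K p" and q: "coeffs_in K q"
  shows "coeffs_in K (p - q)" "coeffs_in K (p + q)" "coeffs_in K (p * q)" "coeffs_in K (pderiv p)"
proof -
  note K' = subfield_setD[OF K]
  have n: "of_nat n \<in> K" for n by (induction n) (auto simp: K')
  show "coeffs_in K (p - q)" "coeffs_in K (p + q)" using p q by (auto simp: coeffs_in_def K')
  show "coeffs_in K (p * q)"
    using p q by (auto simp: coeffs_in_def coeff_mult K' intro!: subfield_set_sum[OF K])
  show "coeffs_in K (pderiv p)"
    using p by (auto simp: coeffs_in_def coeff_pderiv simp del: of_nat_Suc intro!: K'(6) n)
qed

lemma coeffs_in_const: "subfield_set K \<Longrightarrow> c \<in> K \<Longrightarrow> coeffs_in K [:c:]"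
  by (auto simp: coeffs_in_def coeff_pCons subfield_setD split: nat.split)

lemma coeffs_in_monom: "subfield_set K \<Longrightarrow> c \<in> K \<Longrightarrow> coeffs_in K (monom c n)"
  by (auto simp: coeffs_in_def subfield_setD)

lemma coeffs_in_pCons: "coeffs_in K (pCons a p) \<longleftrightarrow> a \<in> K \<and> coeffs_in K p"
  by (auto simp: coeffs_in_def coeff_pCons split: nat.splits)

section \<open>Convex subrings of an ordered field and their maximal ideals\<close>

locale convex_subring =
  fixes R :: "'a::linordered_field set"
  assumes one: "1 \<in> R"
    and add: "x \<in> R \<Longrightarrow> y \<in> R \<Longrightarrow> x + y \<in> R"
    and mult: "x \<in> R \<Longrightarrow> y \<in> R \<Longrightarrow> x * y \<in> R"
    and convex: "y \<in> R \<Longrightarrow> \<bar>x\<bar> \<le> \<bar>y\<bar> \<Longrightarrow> x \<in> R"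
begin

text \<open>This is the maximal ideal of the valuation ring: a nonzero \<open>x\<close> belongs to
  it iff \<open>inverse x\<close> lies outside \<open>R\<close>. Testing products instead of
  inverses spares a separate case for \<open>0\<close>.\<close>

definition small :: "'a set" where "small = {x. \<forall>y\<in>R. \<bar>x * y\<bar> < 1}"

lemma zero: "0 \<in> R" by (rule convex[OF one]) simp

lemma uminus: "x \<in> R \<Longrightarrow> - x \<in> R" by (rule convex) auto

lemma diff: "x \<in> R \<Longrightarrow> y \<in> R \<Longrightarrow> x - y \<in> R" using add[OF _ uminus, of x y] by simp

lemma small_less_one: "x \<in> small \<Longrightarrow> \<bar>x\<bar> < 1" using one by (force simp: small_def)

lemma small_subset: "x \<in> small \<Longrightarrow> x \<in> R"
  by (rule convex[OF one]) (use small_less_one in force)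

lemma inverse_mem: "x \<notin> small \<Longrightarrow> inverse x \<in> R"
proof -
  assume "x \<notin> small"
  then obtain y where y: "y \<in> R" "\<bar>x * y\<bar> \<ge> 1" by (force simp: small_def)
  then have "x \<noteq> 0" by auto
  then have "\<bar>inverse x\<bar> \<le> \<bar>y\<bar>" using y by (simp add: abs_mult field_simps)
  then show ?thesis using convex y by blast
qed

lemma small_mult: "x \<in> small \<Longrightarrow> y \<in> R \<Longrightarrow> x * y \<in> small"
  using mult by (simp add: small_def mult.assoc)

lemma small_mult': "x \<in> small \<Longrightarrow> y \<in> R \<Longrightarrow> y * x \<in> small"
  using small_mult by (simp add: mult.commute)

lemma small_zero: "0 \<in> small" by (auto simp: small_def)

lemma small_add: "x \<in> small \<Longrightarrow> y \<in> small \<Longrightarrow> x + y \<in> small"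
proof -
  assume x: "x \<in> small" and y: "y \<in> small"
  show ?thesis unfolding small_def
  proof safe
    fix w assume "w \<in> R"
    \<comment> \<open>Testing against \<open>w + w\<close> instead of \<open>w\<close> bounds each
      of the two products with \<open>w\<close> by 1/2.\<close>
    then have "w + w \<in> R" using add by blast
    then have "\<bar>x * (w + w)\<bar> < 1" "\<bar>y * (w + w)\<bar> < 1" using x y by (auto simp: small_def)
    then show "\<bar>(x + y) * w\<bar> < 1" by (auto simp: algebra_simps abs_if split: if_splits)
  qed
qed

lemma small_uminus: "x \<in> small \<Longrightarrow> - x \<in> small" by (auto simp: small_def)

lemma small_diff: "x \<in> small \<Longrightarrow> y \<in> small \<Longrightarrow> x - y \<in> small"
  using small_add[OF _ small_uminus, of x y] by simp

lemma small_convex: "y \<in> small \<Longrightarrow> \<bar>x\<bar> \<le> \<bar>y\<bar> \<Longrightarrow> x \<in> small"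
  unfolding small_def abs_mult
  by (blast intro: le_less_trans mult_right_mono abs_ge_zero)

text \<open>A nonzero element of \<open>K\<close> has its inverse in \<open>K\<close>, hence in
  \<open>R\<close>, and their product is 1. So reduction modulo \<open>small\<close> is injective on
  \<open>K\<close>; this is what later turns small values into zeros.\<close>

lemma subfield_small:
  assumes "subfield_set K" "K \<subseteq> R" "x \<in> K" "x \<in> small"
  shows "x = 0"
proof (rule ccontr)
  assume "x \<noteq> 0"
  moreover have "inverse x \<in> R" using subfield_setD(7)[OF assms(1,3)] assms(2) by auto
  then have "\<bar>x * inverse x\<bar> < 1" using assms(4) unfolding small_def by blast
  ultimately show False by simp
qed

lemma poly_mem: "coeffs_in R p \<Longrightarrow> x \<in> R \<Longrightarrow> poly p x \<in> R"
  by (induction p) (auto simp: coeffs_in_pCons zero add mult)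

lemma poly_diff_small:
  assumes "coeffs_in R p" "x \<in> R" "y \<in> R" "x - y \<in> small"
  shows "poly p x - poly p y \<in> small"
  using assms(1)
proof (induction p)
  case (pCons a p)
  have "poly (pCons a p) x - poly (pCons a p) y = (x - y) * poly p x + y * (poly p x - poly p y)"
    by (simp add: algebra_simps)
  moreover have "(x - y) * poly p x + y * (poly p x - poly p y) \<in> small"
    using pCons assms by (intro small_add small_mult small_mult' poly_mem) (auto simp: coeffs_in_pCons)
  ultimately show ?case by (simp only:)
qed (simp add: small_zero)

text \<open>The remainder is built by recursion on the coefficients, not from a divided second
  derivative, so that its membership in \<open>R\<close> follows from closure under ring
  operations.\<close>

lemma taylor2:
  assumes "coeffs_in R p" "x \<in> R" "h \<in> R"
  shows "\<exists>r\<in>R. poly p (x + h) = poly p x + poly (pderiv p) x * h + h * h * r"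
  using assms(1)
proof (induction p)
  case (pCons a p)
  then obtain r where r: "r \<in> R" "poly p (x + h) = poly p x + poly (pderiv p) x * h + h * h * r"
    by (auto simp: coeffs_in_pCons)
  have "of_nat n \<in> R" for n by (induction n) (auto simp: zero one add)
  then have "coeffs_in R (pderiv p)"
    using pCons by (auto simp: coeffs_in_def coeff_pderiv coeff_pCons split: nat.splits
      simp del: of_nat_Suc intro!: mult)
  then have "poly (pderiv p) x + x * r + h * r \<in> R"
    using assms r by (auto intro!: add mult poly_mem)
  moreover have "poly (pCons a p) (x + h) = poly (pCons a p) x + poly (pderiv (pCons a p)) x * h
      + h * h * (poly (pderiv p) x + x * r + h * r)"
    using r by (simp add: pderiv_pCons algebra_simps)
  ultimately show ?case by blast
qed (use zero in auto)

end

text \<open>The assumption concerns the ambient field only: an ordered field with the intermediate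
  value property for polynomials is real closed. Convexity then yields Hensel's lemma for
  \<open>R\<close>.\<close>

locale henselian_subring = convex_subring R for R :: "'a::linordered_field set" +
  assumes poly_IVT: "\<And>p a b. a < b \<Longrightarrow> poly p a * poly p b < (0::'a) \<Longrightarrow> \<exists>x>a. x < b \<and> poly p x = 0"
begin

text \<open>One Newton step replaces the usual iteration. With \<open>u\<close> the Newton
  correction, the values at \<open>x + 2 * u\<close> and \<open>x - 2 * u\<close> are
  \<open>P\<close> times 3 and \<open>P\<close> times -1, up to relative errors below 1. The sign
  change traps a root at distance at most \<open>2 * u\<close> from \<open>x\<close>.\<close>

lemma simple_root_lift:
  assumes p: "coeffs_in R p" and x: "x \<in> R" and P: "poly p x \<in> small" and D: "poly (pderiv p) x \<notin> small"
  shows "\<exists>y. x - y \<in> small \<and> poly p y = 0"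
proof (cases "poly p x = 0")
  case True
  then show ?thesis using small_zero by (intro exI[of _ x]) auto
next
  case False
  define P where "P = poly p x"
  define D where "D = poly (pderiv p) x"
  define u where "u = P * inverse D"
  have D0: "D \<noteq> 0" using assms(4) small_zero unfolding D_def by metis
  have iD: "inverse D \<in> R" using inverse_mem D unfolding D_def by blast
  have u: "u \<in> small" using P iD unfolding u_def P_def by (intro small_mult)
  have u2: "2 * u \<in> small" using small_add[OF u u] by simp
  have Du: "D * u = P" using D0 by (simp add: u_def)
  obtain r where r: "r \<in> R" "poly p (x + 2 * u) = P + D * (2 * u) + (2 * u) * (2 * u) * r"
    using taylor2[OF p x, of "2 * u"] small_subset[OF u2] unfolding P_def D_def by blast
  obtain s where s: "s \<in> R" "poly p (x + - (2 * u)) = P + D * (- (2 * u)) + (2 * u) * (2 * u) * s"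
    using taylor2[OF p x, of "- (2 * u)"] uminus[OF small_subset[OF u2]] unfolding P_def D_def by auto
  have 1: "\<bar>2 * (2 * u) * inverse D * r\<bar> < 1" "\<bar>2 * (2 * u) * inverse D * s\<bar> < 1"
    using small_add[OF u2 u2] iD r(1) s(1)
    by (auto intro!: small_less_one small_mult)
  \<comment> \<open>One factor \<open>u\<close> is written as \<open>P * inverse D\<close>, so the
    quadratic remainder becomes \<open>P\<close> times an element of \<open>small\<close>.\<close>
  have sq: "(2 * u) * (2 * u) * t = P * (2 * (2 * u) * inverse D * t)" for t
    by (simp add: u_def mult_ac)
  have r': "poly p (x + 2 * u) = P * (3 + 2 * (2 * u) * inverse D * r)"
    unfolding r(2) sq Du[symmetric] by (simp add: algebra_simps)
  have s': "poly p (x - 2 * u) = P * (- 1 + 2 * (2 * u) * inverse D * s)"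
    using s(2) unfolding sq Du[symmetric] by (simp add: algebra_simps)
  have "P \<noteq> 0" using False by (simp add: P_def)
  then have "poly p (x - 2 * u) * poly p (x + 2 * u) < 0"
  proof -
    have "(- 1 + 2 * (2 * u) * inverse D * s) < 0" "(3 + 2 * (2 * u) * inverse D * r) > 0"
      using 1 by linarith+
    then have "(- 1 + 2 * (2 * u) * inverse D * s) * (3 + 2 * (2 * u) * inverse D * r) < 0"
      by (rule mult_neg_pos)
    moreover have "P * P > 0" using \<open>P \<noteq> 0\<close> by (simp add: zero_less_mult_iff) linarith
    ultimately have "P * P * ((- 1 + 2 * (2 * u) * inverse D * s) * (3 + 2 * (2 * u) * inverse D * r)) < 0"
      by (rule mult_pos_neg[rotated])
    then show ?thesis unfolding r' s' by (simp add: mult_ac)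
  qed
  moreover have "u \<noteq> 0" using \<open>P \<noteq> 0\<close> D0 by (simp add: u_def)
  ultimately obtain y where "poly p y = 0" "\<bar>x - y\<bar> \<le> \<bar>2 * u\<bar>"
    using poly_IVT[of "x - 2 * u" "x + 2 * u" p] poly_IVT[of "x + 2 * u" "x - 2 * u" p]
    by (cases "u > 0") (force simp: mult.commute)+
  then show ?thesis using small_convex[OF u2] by auto
qed

text \<open>The field generated by \<open>z\<close> over \<open>K\<close> consists of quotients of
  polynomial values at \<open>z\<close>; \<open>units\<close> makes every denominator invertible
  inside \<open>R\<close>. Algebraic and transcendental \<open>z\<close> are treated alike.\<close>

lemma simple_extension_mem:
  assumes K: "subfield_set K" "K \<subseteq> R" and z: "z \<in> R"
    and units: "\<And>b. coeffs_in K b \<Longrightarrow> poly b z \<noteq> 0 \<Longrightarrow> poly b z \<notin> small"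
  shows "\<exists>L. subfield_set L \<and> K \<subseteq> L \<and> L \<subseteq> R \<and> z \<in> L"
proof -
  define L where "L = {poly a z / poly b z | a b. coeffs_in K a \<and> coeffs_in K b \<and> poly b z \<noteq> 0}"
  have LI: "w \<in> L" if "coeffs_in K a" "coeffs_in K b" "poly b z \<noteq> 0" "w = poly a z / poly b z" for a b w
    using that unfolding L_def by blast
  note c = coeffs_in_const[OF K(1)] and ops = coeffs_in_ops[OF K(1)] and K' = subfield_setD[OF K(1)]
  have one: "coeffs_in K [:1:]" using c K' by simp
  have "K \<subseteq> L" using one by (auto intro!: LI[of "[:_:]" "[:1:]"] c)
  moreover have "coeffs_in K [:0, 1:]" unfolding coeffs_in_pCons[of _ 0] using one K' by simp
  then have "z \<in> L" using one by (intro LI[of "[:0, 1:]" "[:1:]"]) auto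
  moreover have "L \<subseteq> R"
  proof
    fix w assume "w \<in> L"
    then obtain a b where ab: "coeffs_in K a" "coeffs_in K b" "poly b z \<noteq> 0" "w = poly a z / poly b z"
      unfolding L_def by blast
    have "coeffs_in R a" using ab K by (auto simp: coeffs_in_def)
    then have "poly a z * inverse (poly b z) \<in> R"
      using units[OF ab(2,3)] z by (intro mult poly_mem inverse_mem)
    then show "w \<in> R" using ab by (simp add: divide_inverse)
  qed
  moreover have "subfield_set L"
    unfolding subfield_set_def
  proof (intro conjI ballI)
    show "1 \<in> L" using \<open>K \<subseteq> L\<close> K' by auto
  next
    fix v w assume "v \<in> L" "w \<in> L"
    then obtain a b c d where ab: "coeffs_in K a" "coeffs_in K b" "poly b z \<noteq> 0" "v = poly a z / poly b z"
      and cd: "coeffs_in K c" "coeffs_in K d" "poly d z \<noteq> 0" "w = poly c z / poly d z"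
      unfolding L_def by blast
    show "v - w \<in> L"
    proof (rule LI)
      show "coeffs_in K (a * d - c * b)" "coeffs_in K (b * d)"
        using ab(1,2) cd(1,2) by (simp_all add: ops)
    qed (use ab cd in \<open>simp_all add: diff_frac_eq\<close>)
    show "v * w \<in> L"
    proof (rule LI)
      show "coeffs_in K (a * c)" "coeffs_in K (b * d)"
        using ab(1,2) cd(1,2) by (simp_all add: ops)
    qed (use ab cd in simp_all)
  next
    fix v assume "v \<in> L"
    then obtain a b where ab: "coeffs_in K a" "coeffs_in K b" "poly b z \<noteq> 0" "v = poly a z / poly b z"
      unfolding L_def by blast
    show "inverse v \<in> L"
    proof (cases "poly a z = 0")
      case True
      then show ?thesis using ab \<open>v \<in> L\<close> by simp
    next
      case False
      then show ?thesis using ab(1-3) by (rule_tac LI[of b a]) (simp_all add: ab(4))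
    qed
  qed
  ultimately show ?thesis by blast
qed

text \<open>Zorn's lemma gives a maximal subfield \<open>K\<close>. If a residue class were missed,
  some element of it could be adjoined without leaving \<open>R\<close>; by maximality that element
  already lies in \<open>K\<close>.\<close>

theorem coefficient_field_exists:
  assumes "subfield_set K0" "K0 \<subseteq> R"
  shows "\<exists>K. subfield_set K \<and> K0 \<subseteq> K \<and> K \<subseteq> R \<and> (\<forall>x\<in>R. \<exists>y\<in>K. x - y \<in> small)"
proof -
  define \<A> where "\<A> = {K. subfield_set K \<and> K0 \<subseteq> K \<and> K \<subseteq> R}"
  have "\<exists>M\<in>\<A>. \<forall>X\<in>\<A>. M \<subseteq> X \<longrightarrow> X = M"
  proof (rule subset_Zorn_nonempty)
    show "\<A> \<noteq> {}" using assms by (auto simp: \<A>_def)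
    fix C assume C: "C \<noteq> {}" "subset.chain \<A> C"
    have sf: "\<And>X. X \<in> C \<Longrightarrow> subfield_set X \<and> K0 \<subseteq> X \<and> X \<subseteq> R"
      using C by (auto simp: subset.chain_def \<A>_def)
    have two: "\<exists>Z\<in>C. x \<in> Z \<and> y \<in> Z" if xy: "x \<in> \<Union>C" "y \<in> \<Union>C" for x y
    proof -
      obtain X Y where "X \<in> C" "Y \<in> C" "x \<in> X" "y \<in> Y" using xy by blast
      then show ?thesis using C(2) subset_chain_def[of \<A> C] by blast
    qed
    have "subfield_set (\<Union>C)" unfolding subfield_set_def
    proof (intro conjI ballI)
      show "1 \<in> \<Union>C" using C(1) sf subfield_setD(2) by (metis UnionI ex_in_conv)
      fix x assume x: "x \<in> \<Union>C"
      then show "inverse x \<in> \<Union>C" using sf by (auto intro: subfield_setD(7))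
      fix y assume y: "y \<in> \<Union>C"
      obtain Z where "Z \<in> C" "x \<in> Z" "y \<in> Z" using two[OF x y] by blast
      then show "x - y \<in> \<Union>C" "x * y \<in> \<Union>C" using sf[OF \<open>Z \<in> C\<close>] by (auto intro!: bexI[of _ Z] dest: subfield_setD(5,6))
    qed
    then show "\<Union>C \<in> \<A>" using C(1) sf by (auto simp: \<A>_def)
  qed
  then obtain K where "K \<in> \<A>" and max: "\<And>X. X \<in> \<A> \<Longrightarrow> K \<subseteq> X \<Longrightarrow> X = K" by blast
  then have K: "subfield_set K" "K0 \<subseteq> K" "K \<subseteq> R" by (auto simp: \<A>_def)
  have maxK: "z \<in> K" if z: "z \<in> R" "\<And>b. coeffs_in K b \<Longrightarrow> poly b z \<noteq> 0 \<Longrightarrow> poly b z \<notin> small" for z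
  proof -
    obtain L where "subfield_set L" "K \<subseteq> L" "L \<subseteq> R" "z \<in> L"
      using simple_extension_mem[OF K(1,3) z] by blast
    then show ?thesis using max[of L] K by (auto simp: \<A>_def)
  qed
  have inR: "coeffs_in K p \<Longrightarrow> coeffs_in R p" for p using K by (auto simp: coeffs_in_def)
  note K' = subfield_setD[OF K(1)]
  have "\<exists>y\<in>K. x - y \<in> small" if x: "x \<in> R" for x
  proof (cases "\<exists>p. coeffs_in K p \<and> p \<noteq> 0 \<and> poly p x \<in> small")
    \<comment> \<open>Here \<open>x\<close> is transcendental over \<open>K\<close> modulo
      \<open>small\<close>: all nonzero polynomials over \<open>K\<close> take unit values at
      \<open>x\<close>, so \<open>x\<close> itself may be adjoined.\<close>
    case False
    then have "x \<in> K" using maxK[OF x] by fastforce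
    then show ?thesis using small_zero by (intro bexI[of _ x]) auto
  next
    case True
    \<comment> \<open>Up to scaling, \<open>p\<close> is the minimal polynomial of the residue of
      \<open>x\<close> over \<open>K\<close>.\<close>
    then obtain p where p: "coeffs_in K p" "p \<noteq> 0" "poly p x \<in> small"
      and min: "\<And>q. coeffs_in K q \<Longrightarrow> q \<noteq> 0 \<Longrightarrow> poly q x \<in> small \<Longrightarrow> degree p \<le> degree q"
      using ex_has_least_nat[of "\<lambda>p. coeffs_in K p \<and> p \<noteq> 0 \<and> poly p x \<in> small" _ degree] by blast
    have deg: "degree p > 0"
    proof (rule ccontr)
      assume "\<not> degree p > 0"
      then obtain c where "p = [:c:]" by (meson degree_eq_zeroE gr0I)
      then show False using p subfield_small[OF K(1,3), of c] by (auto simp: coeffs_in_pCons)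
    qed
    \<comment> \<open>In characteristic zero \<open>pderiv p\<close> is nonzero and has smaller
      degree than \<open>p\<close>, so minimality forbids a small value: the root modulo
      \<open>small\<close> is simple.\<close>
    have "poly (pderiv p) x \<notin> small"
    proof
      assume "poly (pderiv p) x \<in> small"
      moreover have "pderiv p \<noteq> 0" using deg by (simp add: pderiv_eq_0_iff)
      ultimately have "degree p \<le> degree (pderiv p)" using min coeffs_in_ops(4)[OF K(1) p(1) p(1)] by blast
      then show False using deg by (simp add: degree_pderiv)
    qed
    then obtain y where y: "x - y \<in> small" "poly p y = 0"
      using simple_root_lift[OF inR[OF p(1)] x p(3)] by blast
    have yR: "y \<in> R" using diff[OF x small_subset[OF y(1)]] by simp
    \<comment> \<open>Subtracting a multiple of \<open>p\<close> lowers the degree and keeps the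
      value at \<open>y\<close>, since \<open>y\<close> is an exact root. Below the degree of
      \<open>p\<close>, minimality applies at \<open>x\<close>, and the values at \<open>x\<close>
      and \<open>y\<close> differ by a small element.\<close>
    have "poly b y \<notin> small" if "coeffs_in K b" "poly b y \<noteq> 0" for b
      using that
    proof (induction "degree b" arbitrary: b rule: less_induct)
      case less
      show ?case
      proof (cases "degree b < degree p")
        case True
        have "b \<noteq> 0" using less.prems by auto
        then have "poly b x \<notin> small" using True min[of b] less.prems by force
        then show ?thesis using poly_diff_small[OF inR[OF less.prems(1)] x yR y(1)]
            small_add[of "poly b x - poly b y" "poly b y"] by auto
      next
        case False
        define c where "c = lead_coeff b / lead_coeff p"
        define b' where "b' = b - monom c (degree b - degree p) * p"
        have ck: "c \<in> K" using less.prems p by (auto simp: c_def coeffs_in_def K')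
        have "coeffs_in K b'"
          unfolding b'_def using less.prems p ck by (intro coeffs_in_ops coeffs_in_monom K) auto
        moreover have e: "poly b' y = poly b y" using y by (simp add: b'_def)
        moreover have "degree b' < degree b"
        proof (rule degree_lessI)
          show "b' \<noteq> 0 \<or> 0 < degree b" using deg False by simp
          show "\<forall>k\<ge>degree b. coeff b' k = 0"
          proof (intro allI impI)
            fix k assume k: "k \<ge> degree b"
            show "coeff b' k = 0"
            proof (cases "k = degree b")
              case True
              then show ?thesis using False p by (auto simp: b'_def coeff_monom_mult c_def)
            next
              case False': False
              then have "coeff b k = 0" "coeff p (k - (degree b - degree p)) = 0"
                using k False by (auto intro!: coeff_eq_0)
              then show ?thesis by (simp add: b'_def coeff_monom_mult)
            qed
          qed
        qed
        ultimately show ?thesis using less by metis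
      qed
    qed
    then have "y \<in> K" using maxK[OF yR] by blast
    then show ?thesis using y by blast
  qed
  then show ?thesis using K by blast
qed

end


section \<open>An ultrapower of the reals\<close>

text \<open>A maximal family is taken among those whose finite intersections are infinite. Asking
  for infinite rather than nonempty intersections makes the ultrafilter free at once.\<close>

lemma ex_free_ultrafilter_sets:
  "\<exists>U :: nat set set. (\<forall>P\<in>U. infinite P) \<and> (\<forall>P. P \<in> U \<or> - P \<in> U) \<and> (\<forall>P\<in>U. \<forall>Q\<in>U. P \<inter> Q \<in> U)"
proof -
  define \<A> :: "nat set set set" where "\<A> = {A. \<forall>S. finite S \<and> S \<subseteq> A \<longrightarrow> infinite (\<Inter>S)}"
  have "\<exists>U\<in>\<A>. \<forall>X\<in>\<A>. U \<subseteq> X \<longrightarrow> X = U"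
  proof (rule subset_Zorn_nonempty)
    have "{} \<in> \<A>" by (auto simp: \<A>_def)
    then show "\<A> \<noteq> {}" by blast
    fix C assume C: "C \<noteq> {}" "subset.chain \<A> C"
    show "\<Union>C \<in> \<A>" unfolding \<A>_def
    proof safe
      fix S assume "finite S" "S \<subseteq> \<Union>C" "finite (\<Inter>S)"
      then obtain A where "A \<in> C" "S \<subseteq> A"
        using finite_subset_Union_chain[OF _ _ C] by metis
      then show False using C \<open>finite S\<close> \<open>finite (\<Inter>S)\<close> by (auto simp: \<A>_def subset.chain_def)
    qed
  qed
  then obtain U where U: "U \<in> \<A>" and max: "\<And>X. X \<in> \<A> \<Longrightarrow> U \<subseteq> X \<Longrightarrow> X = U" by blast
  have inf: "infinite (\<Inter>S)" if "finite S" "S \<subseteq> U" for S using U that by (auto simp: \<A>_def)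
  \<comment> \<open>By maximality, a set outside \<open>U\<close> meets some finite intersection of
    members of \<open>U\<close> in a finite set. If this held for both \<open>P\<close> and its
    complement, the two finite traces would cover a finite intersection of members of
    \<open>U\<close>.\<close>
  have out: "\<exists>S. finite S \<and> S \<subseteq> U \<and> finite (\<Inter>S \<inter> P)" if "P \<notin> U" for P
  proof -
    have "insert P U \<notin> \<A>" using max[of "insert P U"] that by auto
    then obtain S where S: "finite S" "S \<subseteq> insert P U" "finite (\<Inter>S)" by (auto simp: \<A>_def)
    have "\<Inter>(S - {P}) \<inter> P \<subseteq> \<Inter>S" by auto
    then show ?thesis using S by (intro exI[of _ "S - {P}"]) (auto intro: finite_subset)
  qed
  have compl: "P \<in> U \<or> - P \<in> U" for P
  proof (rule ccontr)
    assume "\<not> ?thesis"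
    then obtain S T where ST: "finite S" "S \<subseteq> U" "finite (\<Inter>S \<inter> P)" "finite T" "T \<subseteq> U" "finite (\<Inter>T \<inter> - P)"
      using out by meson
    have "\<Inter>(S \<union> T) \<subseteq> (\<Inter>S \<inter> P) \<union> (\<Inter>T \<inter> - P)" by auto
    then have "finite (\<Inter>(S \<union> T))" using ST by (meson finite_UnI finite_subset)
    then show False using inf[of "S \<union> T"] ST by blast
  qed
  moreover have "P \<inter> Q \<in> U" if "P \<in> U" "Q \<in> U" for P Q
  proof (rule ccontr)
    assume "P \<inter> Q \<notin> U"
    then have "- (P \<inter> Q) \<in> U" using compl by blast
    then have "infinite (\<Inter>{P, Q, - (P \<inter> Q)})" using that by (intro inf) simp_all
    moreover have "\<Inter>{P, Q, - (P \<inter> Q)} = {}" by blast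
    ultimately show False by (simp only: finite.emptyI not_True_eq_False)
  qed
  moreover have "infinite P" if "P \<in> U" for P using inf[of "{P}"] that by simp
  ultimately show ?thesis by (intro exI[of _ U]) simp
qed

lemma ex_free_ultrafilter:
  "\<exists>F :: nat filter. F \<noteq> bot \<and> F \<le> sequentially \<and> (\<forall>P. eventually P F \<or> eventually (\<lambda>n. \<not> P n) F)"
proof -
  obtain U :: "nat set set" where "(\<forall>P\<in>U. infinite P) \<and> (\<forall>P. P \<in> U \<or> - P \<in> U) \<and> (\<forall>P\<in>U. \<forall>Q\<in>U. P \<inter> Q \<in> U)"
    using ex_free_ultrafilter_sets by (rule exE)
  then have U: "\<And>P. P \<in> U \<Longrightarrow> infinite P" "\<And>P. P \<in> U \<or> - P \<in> U"
    "\<And>P Q. P \<in> U \<Longrightarrow> Q \<in> U \<Longrightarrow> P \<inter> Q \<in> U"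
    by auto
  have disj: "P \<in> U \<Longrightarrow> Q \<in> U \<Longrightarrow> P \<inter> Q \<noteq> {}" for P Q
    using U(1)[OF U(3), of P Q] by auto
  have mono: "P \<in> U \<Longrightarrow> P \<subseteq> Q \<Longrightarrow> Q \<in> U" for P Q
    using U(2)[of Q] disj[of P "- Q"] by blast
  define F where "F = Abs_filter (\<lambda>P. {n. P n} \<in> U)"
  have ev: "eventually P F \<longleftrightarrow> {n. P n} \<in> U" for P
    unfolding F_def
  proof (rule eventually_Abs_filter, rule is_filter.intro)
    show "{n. True} \<in> U" using U(1)[of "{}"] U(2)[of UNIV] by auto
    show "{n. P n \<and> Q n} \<in> U" if "{n. P n} \<in> U" "{n. Q n} \<in> U" for P Q
      using U(3)[OF that] by (simp add: Collect_conj_eq)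
    show "{n. Q n} \<in> U" if "\<forall>x. P x \<longrightarrow> Q x" "{n. P n} \<in> U" for P Q
      by (rule mono[OF that(2)]) (use that(1) in auto)
  qed
  have "F \<noteq> bot" using U(1)[of "{}"] ev[of "\<lambda>_. False"] by (auto simp: trivial_limit_def)
  moreover have "F \<le> sequentially"
  proof (rule filter_leI)
    fix P assume "eventually P sequentially"
    then have "finite (- {n. P n})"
      by (simp add: eventually_cofinite[symmetric] cofinite_eq_sequentially Collect_neg_eq[symmetric])
    then show "eventually P F" using U(1,2) ev by blast
  qed
  moreover have "eventually P F \<or> eventually (\<lambda>n. \<not> P n) F" for P
    using U(2)[of "{n. P n}"] ev by (simp add: Collect_neg_eq)
  ultimately show ?thesis by blast
qed

section \<open>The ultrapower as an ordered field\<close>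

definition ultra :: "nat filter" where
  "ultra = (SOME F. F \<noteq> bot \<and> F \<le> sequentially \<and> (\<forall>P. eventually P F \<or> eventually (\<lambda>n. \<not> P n) F))"

lemma ultra_nontrivial: "ultra \<noteq> bot"
  and ultra_le: "ultra \<le> sequentially"
  and ultra_cases: "eventually P ultra \<or> eventually (\<lambda>n. \<not> P n) ultra"
  using someI_ex[OF ex_free_ultrafilter] unfolding ultra_def by blast+

text \<open>This is the point where the ultrafilter property enters the algebra: negations pass
  through \<open>eventually\<close>, which gives inverses of nonzero elements and the strict
  order.\<close>

lemma eventually_ultra_not: "eventually (\<lambda>n. \<not> P n) ultra \<longleftrightarrow> \<not> eventually P ultra"
proof
  assume "eventually (\<lambda>n. \<not> P n) ultra"
  then show "\<not> eventually P ultra"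
    using ultra_nontrivial eventually_elim2[of "\<lambda>n. \<not> P n" ultra P "\<lambda>_. False"]
    by (auto simp: trivial_limit_def)
qed (use ultra_cases in blast)

quotient_type hyper = "nat \<Rightarrow> real" / "\<lambda>f g. eventually (\<lambda>n. f n = g n) ultra"
  morphisms hyper_rep hyper_of
proof (rule equivpI)
  show "reflp (\<lambda>f g. eventually (\<lambda>n. f n = g n) ultra)" by (simp add: reflp_def)
  show "symp (\<lambda>f g. eventually (\<lambda>n. f n = g n) ultra)" by (simp add: symp_def eq_commute)
  show "transp (\<lambda>f g. eventually (\<lambda>n. f n = g n) ultra)"
    by (auto simp: transp_def elim: eventually_elim2)
qed

instantiation hyper :: linordered_field
begin

lift_definition zero_hyper :: hyper is "\<lambda>_. 0" .
lift_definition one_hyper :: hyper is "\<lambda>_. 1" .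
lift_definition plus_hyper :: "hyper \<Rightarrow> hyper \<Rightarrow> hyper" is "\<lambda>f g n. f n + g n"
  by (auto elim: eventually_elim2)
lift_definition minus_hyper :: "hyper \<Rightarrow> hyper \<Rightarrow> hyper" is "\<lambda>f g n. f n - g n"
  by (auto elim: eventually_elim2)
lift_definition times_hyper :: "hyper \<Rightarrow> hyper \<Rightarrow> hyper" is "\<lambda>f g n. f n * g n"
  by (auto elim: eventually_elim2)
lift_definition divide_hyper :: "hyper \<Rightarrow> hyper \<Rightarrow> hyper" is "\<lambda>f g n. f n / g n"
  by (auto elim: eventually_elim2)
lift_definition uminus_hyper :: "hyper \<Rightarrow> hyper" is "\<lambda>f n. - f n"
  by (auto elim: eventually_mono)
lift_definition inverse_hyper :: "hyper \<Rightarrow> hyper" is "\<lambda>f n. inverse (f n)"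
  by (auto elim: eventually_mono)
lift_definition abs_hyper :: "hyper \<Rightarrow> hyper" is "\<lambda>f n. \<bar>f n\<bar>"
  by (auto elim: eventually_mono)
lift_definition sgn_hyper :: "hyper \<Rightarrow> hyper" is "\<lambda>f n. sgn (f n)"
  by (auto elim: eventually_mono)
lift_definition less_eq_hyper :: "hyper \<Rightarrow> hyper \<Rightarrow> bool" is "\<lambda>f g. eventually (\<lambda>n. f n \<le> g n) ultra"
proof -
  fix f f' g g' :: "nat \<Rightarrow> real"
  assume "\<forall>\<^sub>F n in ultra. f n = f' n" "\<forall>\<^sub>F n in ultra. g n = g' n"
  then have "\<forall>\<^sub>F n in ultra. (f n \<le> g n) = (f' n \<le> g' n)" by eventually_elim simp
  then show "(\<forall>\<^sub>F n in ultra. f n \<le> g n) = (\<forall>\<^sub>F n in ultra. f' n \<le> g' n)"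
    by (rule eventually_subst)
qed

definition less_hyper :: "hyper \<Rightarrow> hyper \<Rightarrow> bool" where "less_hyper x y \<longleftrightarrow> \<not> y \<le> x"

instance
proof
  fix a b c :: hyper
  show "a + b + c = a + (b + c)" by transfer (simp add: add.assoc)
  show "a + b = b + a" by transfer (simp add: add.commute)
  show "0 + a = a" by transfer simp
  show "- a + a = 0" by transfer simp
  show "a - b = a + - b" by transfer simp
  show "a * b * c = a * (b * c)" by transfer (simp add: mult.assoc)
  show "a * b = b * a" by transfer (simp add: mult.commute)
  show "1 * a = a" by transfer simp
  show "(a + b) * c = a * c + b * c" by transfer (simp add: algebra_simps)
  show "0 * a = 0" by transfer simp
  show "a * 0 = 0" by transfer simp
  show "a + b - a = b" by transfer simp
  show "a - b - c = a - (b + c)" by transfer (simp add: algebra_simps)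
  show "(0::hyper) \<noteq> 1" by transfer (use ultra_nontrivial in simp)
  show "a \<noteq> 0 \<Longrightarrow> inverse a * a = 1"
    by transfer (auto simp: eventually_ultra_not[symmetric] elim: eventually_mono)
  show "a div b = a * inverse b" by transfer (simp add: divide_inverse)
  show "inverse (0::hyper) = 0" by transfer simp
  show "a \<le> a" by transfer simp
  show "a \<le> b \<Longrightarrow> b \<le> c \<Longrightarrow> a \<le> c" by transfer (auto elim: eventually_elim2)
  show "a \<le> b \<Longrightarrow> b \<le> a \<Longrightarrow> a = b" by transfer (auto elim: eventually_elim2)
  show total: "a \<le> b \<or> b \<le> a" for a b :: hyper
    by transfer (use ultra_cases in \<open>force elim: eventually_mono\<close>)
  show "(a < b) = (a \<le> b \<and> \<not> b \<le> a)" using total by (auto simp: less_hyper_def)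
  show "a \<le> b \<Longrightarrow> c + a \<le> c + b" by transfer simp
  have mult_pos: "0 < a \<Longrightarrow> 0 < b \<Longrightarrow> 0 < a * b" for a b :: hyper
    unfolding less_hyper_def
    by transfer (auto simp: eventually_ultra_not[symmetric] not_le elim: eventually_elim2)
  have diff_pos: "0 < b - a" if "a < b" for a b :: hyper using that
    unfolding less_hyper_def by transfer (simp add: algebra_simps)
  then show "a < b \<Longrightarrow> 0 < c \<Longrightarrow> c * a < c * b"
  proof -
    assume "a < b" "0 < c"
    then have "0 < c * (b - a)" using diff_pos mult_pos by blast
    then show ?thesis unfolding less_hyper_def by transfer (simp add: algebra_simps)
  qed
  show "\<bar>a\<bar> = (if a < 0 then - a else a)"
    unfolding less_hyper_def
    by transfer (auto simp: eventually_ultra_not[symmetric] elim: eventually_mono)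
  show "sgn a = (if a = 0 then 0 else if 0 < a then 1 else - 1)"
    unfolding less_hyper_def
    by transfer (auto simp: eventually_ultra_not[symmetric] elim: eventually_mono eventually_elim2)
qed

end


section \<open>Computing with representatives, and transfer of the intermediate value
  theorem\<close>

lemma hyper_of_ops:
  "hyper_of f + hyper_of g = hyper_of (\<lambda>n. f n + g n)"
  "hyper_of f - hyper_of g = hyper_of (\<lambda>n. f n - g n)"
  "hyper_of f * hyper_of g = hyper_of (\<lambda>n. f n * g n)"
  "inverse (hyper_of f) = hyper_of (\<lambda>n. inverse (f n))"
  "\<bar>hyper_of f\<bar> = hyper_of (\<lambda>n. \<bar>f n\<bar>)"
  "0 = hyper_of (\<lambda>_. 0)" "1 = hyper_of (\<lambda>_. 1)"
  by (simp_all add: plus_hyper.abs_eq minus_hyper.abs_eq times_hyper.abs_eq inverse_hyper.abs_eq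
      abs_hyper.abs_eq zero_hyper_def one_hyper_def)

lemma hyper_of_power: "hyper_of f ^ k = hyper_of (\<lambda>n. f n ^ k)"
  by (induction k) (simp_all add: hyper_of_ops)

lemma hyper_of_le: "hyper_of f \<le> hyper_of g \<longleftrightarrow> eventually (\<lambda>n. f n \<le> g n) ultra"
  by (simp add: less_eq_hyper.abs_eq)

lemma hyper_of_less: "hyper_of f < hyper_of g \<longleftrightarrow> eventually (\<lambda>n. f n < g n) ultra"
  by (simp add: less_hyper_def hyper_of_le eventually_ultra_not[symmetric] not_le)

lemma hyper_of_eq: "hyper_of f = hyper_of g \<longleftrightarrow> eventually (\<lambda>n. f n = g n) ultra"
  by (rule hyper.abs_eq_iff)

lemma hyper_of_rep: "hyper_of (hyper_rep x) = x"
  by (rule Quotient_abs_rep[OF Quotient_hyper])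

text \<open>Representatives of the finitely many coefficients are fixed once, so a single sequence
  of real polynomials serves all arguments \<open>f\<close>.\<close>

lemma hyper_poly_lift: "\<exists>q. \<forall>f. poly p (hyper_of f) = hyper_of (\<lambda>n. poly (q n) (f n))"
proof (induction p)
  case 0
  show ?case by (intro exI[of _ "\<lambda>_. 0"]) (simp add: hyper_of_ops)
next
  case (pCons a p)
  then obtain q where "\<forall>f. poly p (hyper_of f) = hyper_of (\<lambda>n. poly (q n) (f n))" by blast
  moreover obtain c where "a = hyper_of c" using hyper_of_rep[of a, symmetric] by blast
  ultimately show ?case
    by (intro exI[of _ "\<lambda>n. pCons (c n) (q n)"]) (simp add: hyper_of_ops)
qed

lemma hyper_poly_IVT:
  fixes a b :: hyper
  assumes "a < b" "poly p a * poly p b < 0"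
  shows "\<exists>x>a. x < b \<and> poly p x = 0"
proof -
  obtain q where q: "\<And>f. poly p (hyper_of f) = hyper_of (\<lambda>n. poly (q n) (f n))"
    using hyper_poly_lift by blast
  obtain f g where f: "a = hyper_of f" and g: "b = hyper_of g"
    using hyper_of_rep[of a, symmetric] hyper_of_rep[of b, symmetric] by blast
  \<comment> \<open>Roots are chosen componentwise. Where no root exists the value of
    \<open>SOME\<close> is arbitrary, but such indices are negligible for
    \<open>ultra\<close>.\<close>
  define h where "h n = (SOME x. x > f n \<and> x < g n \<and> poly (q n) x = 0)" for n
  have "eventually (\<lambda>n. f n < g n \<and> poly (q n) (f n) * poly (q n) (g n) < 0) ultra"
    using assms by (simp add: f g q hyper_of_ops hyper_of_less eventually_conj_iff)
  then have "eventually (\<lambda>n. h n > f n \<and> h n < g n \<and> poly (q n) (h n) = 0) ultra"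
  proof eventually_elim
    case (elim n)
    then have "\<exists>x. x > f n \<and> x < g n \<and> poly (q n) x = 0" using poly_IVT[of "f n" "g n" "q n"] by blast
    then show ?case unfolding h_def by (rule someI_ex)
  qed
  then show ?thesis
    by (intro exI[of _ "hyper_of h"])
      (simp add: f g q hyper_of_ops hyper_of_less hyper_of_eq eventually_conj_iff)
qed


section \<open>The inequality of Lojasiewicz for real algebraic sets\<close>

text \<open>The expressions stand for multivariate polynomials; the map \<open>h\<close> embeds the real coefficients,
  so that the same expression can be evaluated in the reals and in the ultrapower.\<close>

datatype 'v pexpr = Const real | Var 'v | Add "'v pexpr" "'v pexpr" | Mult "'v pexpr" "'v pexpr"

primrec pvars :: "'v pexpr \<Rightarrow> 'v set" where
  "pvars (Const c) = {}"
| "pvars (Var i) = {i}"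
| "pvars (Add p q) = pvars p \<union> pvars q"
| "pvars (Mult p q) = pvars p \<union> pvars q"

primrec peval :: "(real \<Rightarrow> 'a::comm_ring_1) \<Rightarrow> ('v \<Rightarrow> 'a) \<Rightarrow> 'v pexpr \<Rightarrow> 'a" where
  "peval h x (Const c) = h c"
| "peval h x (Var i) = x i"
| "peval h x (Add p q) = peval h x p + peval h x q"
| "peval h x (Mult p q) = peval h x p * peval h x q"

lemma peval_hyper_of:
  "peval (\<lambda>c. hyper_of (\<lambda>_. c)) (\<lambda>i. hyper_of (\<lambda>n. x n i)) p = hyper_of (\<lambda>n. peval id (x n) p)"
  by (induction p) (simp_all add: hyper_of_ops)

lemma peval_mem:
  assumes "subfield_set K" "\<And>c. h c \<in> K" "\<And>i. i \<in> pvars p \<Longrightarrow> x i \<in> K"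
  shows "peval h x p \<in> K"
  using assms(3) by (induction p) (auto simp: assms(2) subfield_setD[OF assms(1)])

lemma (in convex_subring) peval_diff_small:
  assumes h: "\<And>c. h c \<in> R"
    and "\<And>i. i \<in> pvars p \<Longrightarrow> x i \<in> R" "\<And>i. i \<in> pvars p \<Longrightarrow> y i \<in> R"
    and "\<And>i. i \<in> pvars p \<Longrightarrow> x i - y i \<in> small"
  shows "peval h x p \<in> R \<and> peval h y p \<in> R \<and> peval h x p - peval h y p \<in> small"
  using assms(2-)
proof (induction p)
  case (Mult p q)
  have "peval h x (Mult p q) - peval h y (Mult p q)
      = (peval h x p - peval h y p) * peval h x q + peval h y p * (peval h x q - peval h y q)"
    by (simp add: algebra_simps)
  moreover have "(peval h x p - peval h y p) * peval h x q + peval h y p * (peval h x q - peval h y q) \<in> small"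
    using Mult by (intro small_add small_mult small_mult') auto
  ultimately show ?case using Mult by (simp only:) (auto intro: mult)
next
  case (Add p q)
  have "peval h x (Add p q) - peval h y (Add p q)
      = (peval h x p - peval h y p) + (peval h x q - peval h y q)"
    by (simp add: algebra_simps)
  moreover have "(peval h x p - peval h y p) + (peval h x q - peval h y q) \<in> small"
    using Add by (intro small_add) auto
  ultimately show ?case using Add by (simp only:) (auto intro: add)
qed (auto simp: h small_zero)

text \<open>These are the elements bounded by every root of \<open>1 / e\<close>, written with
  powers because the field need not contain roots. For infinitesimal \<open>e\<close> this is the
  largest convex subring without \<open>inverse e\<close>: a \<open>z\<close> violating the
  condition has a power exceeding \<open>1 / e\<close>.\<close>

definition moderate :: "'a::linordered_field \<Rightarrow> 'a set" where
  "moderate e = {z. \<forall>k. \<bar>z\<bar> ^ k * e \<le> 1}"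

text \<open>For products, the square of the quantity at exponent \<open>k\<close> factors into the
  quantities of \<open>x\<close> and \<open>y\<close> at exponent \<open>2 * k\<close>. Sums are at
  most twice the larger summand, and 2 is moderate because \<open>e\<close> is below every inverse
  power of 4.\<close>

lemma moderate_subring:
  fixes e :: "'a::linordered_field"
  assumes e: "e > 0" "\<And>k. 4 ^ k * e \<le> 1"
  shows "convex_subring (moderate e)"
proof
  have e1: "e \<le> 1" using e(2)[of 0] by simp
  show "1 \<in> moderate e" using e1 by (simp add: moderate_def)
  have two: "2 \<in> moderate e"
  proof -
    have "(2::'a) ^ k * e \<le> 4 ^ k * e" for k using e by (intro mult_right_mono power_mono) auto
    then show ?thesis using e(2) by (auto simp: moderate_def intro: order_trans)
  qed
  show mult: "x * y \<in> moderate e" if x: "x \<in> moderate e" and y: "y \<in> moderate e" for x y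
    unfolding moderate_def
  proof safe
    fix k
    have "(\<bar>x\<bar> ^ (2 * k) * e) * (\<bar>y\<bar> ^ (2 * k) * e) \<le> 1 * 1"
      using x y e by (intro mult_mono) (auto simp: moderate_def simp del: power_mult)
    moreover have "(\<bar>x * y\<bar> ^ k * e) ^ 2 = (\<bar>x\<bar> ^ (2 * k) * e) * (\<bar>y\<bar> ^ (2 * k) * e)"
      unfolding mult_2 power_add by (simp add: abs_mult power_mult_distrib power2_eq_square mult_ac)
    ultimately have "(\<bar>x * y\<bar> ^ k * e) ^ 2 \<le> 1 ^ 2" by simp
    then show "\<bar>x * y\<bar> ^ k * e \<le> 1" by (rule power2_le_imp_le) simp
  qed
  show convex: "x \<in> moderate e" if y: "y \<in> moderate e" and "\<bar>x\<bar> \<le> \<bar>y\<bar>" for x y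
    unfolding moderate_def
  proof safe
    fix k
    have "\<bar>x\<bar> ^ k * e \<le> \<bar>y\<bar> ^ k * e" using that e by (intro mult_right_mono power_mono) auto
    also have "\<dots> \<le> 1" using y by (simp add: moderate_def)
    finally show "\<bar>x\<bar> ^ k * e \<le> 1" .
  qed
  show "x + y \<in> moderate e" if "x \<in> moderate e" "y \<in> moderate e" for x y
  proof (cases "\<bar>x\<bar> \<le> \<bar>y\<bar>")
    case True
    then show ?thesis by (intro convex[OF mult[OF two that(2)]]) (use abs_triangle_ineq[of x y] in \<open>simp add: abs_mult\<close>)
  next
    case False
    then show ?thesis by (intro convex[OF mult[OF two that(1)]]) (use abs_triangle_ineq[of x y] in \<open>simp add: abs_mult\<close>)
  qed
qed

text \<open>This is the origin of the exponent in the inequality: the inverse of a nonzero small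
  \<open>z\<close> is not moderate, and the power witnessing this bounds \<open>z\<close> by a root
  of \<open>e\<close>.\<close>

lemma moderate_small_power:
  fixes e :: "'a::linordered_field"
  assumes e: "e > 0" "\<And>k. 4 ^ k * e \<le> 1" and z: "z \<in> convex_subring.small (moderate e)"
  shows "\<exists>k\<ge>1. \<bar>z\<bar> ^ k \<le> e"
proof (cases "z = 0")
  case True
  then show ?thesis using e by (intro exI[of _ 1]) auto
next
  case False
  interpret convex_subring "moderate e" using moderate_subring[OF e] by blast
  have "inverse z \<notin> moderate e"
  proof
    assume "inverse z \<in> moderate e"
    then have "\<bar>z * inverse z\<bar> < 1" using z unfolding small_def by blast
    then show False using False by simp
  qed
  then obtain k where k: "\<bar>inverse z\<bar> ^ k * e > 1" unfolding moderate_def not_le[symmetric] by blast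
  then have "\<bar>z\<bar> ^ k \<le> e" using False by (simp add: power_inverse field_simps)
  moreover have "k \<noteq> 0" using k e(2)[of 0] by (intro notI) auto
  ultimately show ?thesis by (intro exI[of _ k]) auto
qed

text \<open>For moderate \<open>w\<close> the square of \<open>e * w\<close> is \<open>e\<close>
  times a number at most 1, and \<open>e\<close> is below 1.\<close>

lemma moderate_self_small:
  fixes e :: "'a::linordered_field"
  assumes e: "e > 0" "\<And>k. 4 ^ k * e \<le> 1"
  shows "e \<in> convex_subring.small (moderate e)"
proof -
  interpret convex_subring "moderate e" using moderate_subring[OF e] by blast
  show ?thesis unfolding small_def
  proof safe
    fix w assume "w \<in> moderate e"
    then have "\<bar>w\<bar> ^ 2 * e \<le> 1" unfolding moderate_def by blast
    then have "\<bar>w\<bar> ^ 2 * e * e \<le> 1 * e" using e by (intro mult_right_mono) auto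
    also have "\<dots> < 1" using e(2)[of 1] e(1) by simp
    finally have "\<bar>e * w\<bar> ^ 2 < 1 ^ 2"
      by (simp add: power2_eq_square mult_ac)
    then show "\<bar>e * w\<bar> < 1" by (rule power2_less_imp_less) simp
  qed
qed

text \<open>The hypotheses force \<open>d \<le> 1\<close>, so exponents may be raised; this merges
  the exponents of the separate coordinates into one.\<close>

lemma le_powr_of_power_le:
  fixes d e :: real
  assumes "0 \<le> d" "d ^ k \<le> e" "e \<le> 1" "1 \<le> k" "k \<le> m"
  shows "d \<le> e powr (1 / real m)"
proof (cases "d = 0")
  case False
  have "d \<le> 1"
  proof (rule ccontr)
    assume "\<not> d \<le> 1"
    then have "1 < d ^ k" using assms by (intro one_less_power) auto
    then show False using assms by simp
  qed
  then have "d ^ m \<le> e" using power_decreasing[OF assms(5,1)] assms by simp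
  have "d = (d powr real m) powr (1 / real m)" using assms False by (simp add: powr_powr)
  also have "\<dots> = (d ^ m) powr (1 / real m)" using assms False by (simp add: powr_realpow)
  also have "\<dots> \<le> e powr (1 / real m)" using \<open>d ^ m \<le> e\<close> assms by (intro powr_mono2) auto
  finally show ?thesis .
qed simp

text \<open>Large \<open>e\<close> is included: the bound \<open>B\<close> and the exact zero
  \<open>z\<close> keep distances bounded, which forces the errors of counterexamples with growing
  constants to tend to zero. Tying exponent and constant to one index makes a single sequence of
  counterexamples enough.\<close>

theorem Lojasiewicz:
  fixes P :: "'v pexpr set"
  assumes "finite I" "finite P" and vars: "\<And>p. p \<in> P \<Longrightarrow> pvars p \<subseteq> I"
    and zero: "\<And>p. p \<in> P \<Longrightarrow> peval id z p = 0"
  shows "\<exists>k\<ge>1. \<exists>C>0. \<forall>x e. e \<ge> 0 \<longrightarrow> (\<forall>i\<in>I. \<bar>x i\<bar> \<le> B) \<longrightarrow> (\<forall>p\<in>P. \<bar>peval id x p\<bar> \<le> e) \<longrightarrow>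
    (\<exists>y. (\<forall>p\<in>P. peval id y p = 0) \<and> (\<forall>i\<in>I. \<bar>x i - y i\<bar> \<le> C * e powr (1 / real k)))"
proof (rule ccontr)
  assume contr: "\<not> ?thesis"
  define good where "good k C x e \<longleftrightarrow> (e \<ge> 0 \<longrightarrow> (\<forall>i\<in>I. \<bar>x i\<bar> \<le> B) \<longrightarrow> (\<forall>p\<in>P. \<bar>peval id x p\<bar> \<le> e) \<longrightarrow>
    (\<exists>y. (\<forall>p\<in>P. peval id y p = 0) \<and> (\<forall>i\<in>I. \<bar>x i - y i\<bar> \<le> C * e powr (1 / real k))))"
    for k :: nat and C e :: real and x :: "'v \<Rightarrow> real"
  have "\<exists>x e. \<not> good (Suc n) (real (Suc n)) x e" for n
  proof (rule ccontr)
    assume "\<not> ?thesis"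
    then have "\<forall>x e. good (Suc n) (real (Suc n)) x e" by blast
    then have "\<exists>k\<ge>1. \<exists>C>0. \<forall>x e. good k C x e"
      by (intro exI[of _ "Suc n"] conjI exI[of _ "real (Suc n)"]) simp_all
    then show False using contr unfolding good_def by (rule notE[rotated])
  qed
  then obtain x e where bad_xe: "\<And>n. \<not> good (Suc n) (real (Suc n)) (x n) (e n)" by metis
  have e0: "e n \<ge> 0" and xB: "i \<in> I \<Longrightarrow> \<bar>x n i\<bar> \<le> B"
    and xe: "p \<in> P \<Longrightarrow> \<bar>peval id (x n) p\<bar> \<le> e n" for n i p
    using bad_xe[of n] unfolding good_def by (simp_all del: of_nat_Suc)
  \<comment> \<open>Any exact zero \<open>y\<close> may be inserted here. Three are used:
    \<open>x n\<close> itself if its error vanishes, the given zero \<open>z\<close>, and the lifted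
    point at the end.\<close>
  have bad: "\<exists>i\<in>I. \<bar>x n i - y i\<bar> > real (Suc n) * e n powr (1 / real (Suc n))"
    if "\<And>p. p \<in> P \<Longrightarrow> peval id y p = 0" for n y
    using bad_xe[of n] that unfolding good_def not_le[symmetric] by blast
  have epos: "e n > 0" for n
  proof (rule ccontr)
    assume "\<not> e n > 0"
    then have "e n = 0" using e0[of n] by simp
    then show False using bad[of "x n" n] xe[of _ n] by auto
  qed
  define D where "D = \<bar>B\<bar> + (\<Sum>i\<in>I. \<bar>z i\<bar>) + 1"
  have D: "D > 0" unfolding D_def by (intro add_nonneg_pos add_nonneg_nonneg sum_nonneg) auto
  \<comment> \<open>Insert \<open>z\<close> into \<open>bad\<close>: \<open>D\<close> bounds all
    distances between the \<open>x n\<close> and \<open>z\<close>, so the root of \<open>e n\<close>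
    is at most \<open>D / real (Suc n)\<close>.\<close>
  have eD: "e n \<le> (D / real (Suc n)) ^ Suc n" for n
  proof -
    obtain i where i: "i \<in> I" "\<bar>x n i - z i\<bar> > real (Suc n) * e n powr (1 / real (Suc n))"
      using bad[of z n] zero by blast
    have "\<bar>z i\<bar> \<le> (\<Sum>i\<in>I. \<bar>z i\<bar>)" using i(1) assms(1) by (intro member_le_sum) auto
    then have "\<bar>x n i - z i\<bar> \<le> D" using xB[OF i(1), of n] unfolding D_def by linarith
    then have "e n powr (1 / real (Suc n)) \<le> D / real (Suc n)"
      using i(2) by (simp add: field_simps del: of_nat_Suc)
    then have "(e n powr (1 / real (Suc n))) ^ Suc n \<le> (D / real (Suc n)) ^ Suc n"
      by (intro power_mono) auto
    moreover have "(e n powr (1 / real (Suc n))) ^ Suc n = e n"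
    proof -
      have "(e n powr (1 / real (Suc n))) ^ Suc n = (e n powr (1 / real (Suc n))) powr real (Suc n)"
        using epos[of n] by (intro powr_realpow[symmetric]) simp
      also have "\<dots> = e n" using epos[of n] by (simp add: powr_powr del: of_nat_Suc)
      finally show ?thesis .
    qed
    ultimately show ?thesis by simp
  qed
  have "e \<longlonglongrightarrow> 0"
  proof (rule tendsto_sandwich[OF _ _ tendsto_const])
    show "\<forall>\<^sub>F n in sequentially. 0 \<le> e n" using e0 by simp
    show "(\<lambda>n. (1/2::real) ^ Suc n) \<longlonglongrightarrow> 0" by (intro LIMSEQ_Suc LIMSEQ_realpow_zero) auto
    show "\<forall>\<^sub>F n in sequentially. e n \<le> (1/2) ^ Suc n"
    proof (rule eventually_sequentiallyI)
      fix n assume n: "nat \<lceil>2 * D\<rceil> \<le> n"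
      then have "2 * D \<le> real (Suc n)" by linarith
      then have "D / real (Suc n) \<le> 1/2" by (simp add: field_simps del: of_nat_Suc)
      then have "(D / real (Suc n)) ^ Suc n \<le> (1/2) ^ Suc n" using D by (intro power_mono) auto
      then show "e n \<le> (1/2) ^ Suc n" by (rule order_trans[OF eD])
    qed
  qed
  then have e_less: "eventually (\<lambda>n. e n < c) ultra" if "c > 0" for c
    using order_tendstoD(2)[of e 0 sequentially c] that ultra_le filter_leD by blast
  define \<epsilon> where "\<epsilon> = hyper_of e"
  have \<epsilon>pos: "\<epsilon> > 0" by (simp add: \<epsilon>_def hyper_of_ops(6) hyper_of_less epos)
  have const_le: "hyper_of (\<lambda>_. c) * \<epsilon> \<le> 1" if "c > 0" for c
    unfolding \<epsilon>_def hyper_of_ops hyper_of_le using e_less[of "1 / c"] that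
    by (auto simp: field_simps elim: eventually_mono)
  have four: "(4::hyper) = hyper_of (\<lambda>_. 4)"
  proof -
    have "(4::hyper) = (1 + 1) * (1 + 1)" by simp
    then show ?thesis unfolding hyper_of_ops by simp
  qed
  have \<epsilon>4: "4 ^ k * \<epsilon> \<le> 1" for k
    unfolding four hyper_of_power by (rule const_le) simp
  note mod = \<epsilon>pos \<epsilon>4
  interpret convex_subring "moderate \<epsilon>" by (rule moderate_subring[OF mod])
  interpret henselian_subring "moderate \<epsilon>" by unfold_locales (rule hyper_poly_IVT)
  define h :: "real \<Rightarrow> hyper" where "h c = hyper_of (\<lambda>_. c)" for c
  have hR: "h c \<in> moderate \<epsilon>" for c
  proof -
    have "h (\<bar>c\<bar> + 1) \<in> moderate \<epsilon>"
      unfolding moderate_def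
    proof safe
      fix k
      have "\<bar>h (\<bar>c\<bar> + 1)\<bar> ^ k = hyper_of (\<lambda>_. (\<bar>c\<bar> + 1) ^ k)"
        by (simp add: h_def hyper_of_ops hyper_of_power)
      then show "\<bar>h (\<bar>c\<bar> + 1)\<bar> ^ k * \<epsilon> \<le> 1" using const_le[of "(\<bar>c\<bar> + 1) ^ k"] by simp
    qed
    then show ?thesis by (rule convex) (simp add: h_def hyper_of_ops hyper_of_le)
  qed
  have "subfield_set (range h)" unfolding subfield_set_def h_def
    by (auto simp: hyper_of_ops)
  then have "\<exists>K. subfield_set K \<and> range h \<subseteq> K \<and> K \<subseteq> moderate \<epsilon> \<and> (\<forall>w\<in>moderate \<epsilon>. \<exists>y\<in>K. w - y \<in> small)"
    by (rule coefficient_field_exists) (use hR in blast)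
  then obtain K where K: "subfield_set K" "range h \<subseteq> K" "K \<subseteq> moderate \<epsilon>"
    and lift: "\<forall>w\<in>moderate \<epsilon>. \<exists>y\<in>K. w - y \<in> small"
    by (elim exE conjE)
  define X where "X i = hyper_of (\<lambda>n. x n i)" for i
  have XR: "X i \<in> moderate \<epsilon>" if "i \<in> I" for i
    by (rule convex[OF hR[of B]]) (use xB[OF that] in \<open>simp add: X_def h_def hyper_of_ops hyper_of_le
      order_trans[OF _ abs_ge_self]\<close>)
  have "\<forall>i\<in>I. \<exists>y. y \<in> K \<and> X i - y \<in> small" using lift XR by blast
  from bchoice[OF this] obtain Y where Y: "\<And>i. i \<in> I \<Longrightarrow> Y i \<in> K" "\<And>i. i \<in> I \<Longrightarrow> X i - Y i \<in> small" by blast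
  define y where "y i = hyper_rep (Y i)" for i
  have y: "Y i = hyper_of (y i)" for i by (simp add: y_def hyper_of_rep)
  \<comment> \<open>The value at \<open>X\<close> is bounded by the small \<open>\<epsilon>\<close>
    and the value at \<open>Y\<close> differs from it by a small element, yet lies in
    \<open>K\<close>; hence it is exactly zero.\<close>
  have Y0: "peval h Y p = 0" if p: "p \<in> P" for p
  proof -
    have "peval h X p \<in> small"
    proof (rule small_convex[OF moderate_self_small[OF mod]])
      show "\<bar>peval h X p\<bar> \<le> \<bar>\<epsilon>\<bar>"
        using xe[OF p] unfolding X_def h_def peval_hyper_of \<epsilon>_def
        by (simp add: hyper_of_ops hyper_of_le order_trans[OF _ abs_ge_self])
    qed
    moreover have "peval h X p - peval h Y p \<in> small"
      using vars[OF p] XR Y subsetD[OF K(3)]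
      by (intro peval_diff_small[THEN conjunct2, THEN conjunct2] hR) (blast+)
    ultimately have "peval h X p - (peval h X p - peval h Y p) \<in> small" by (rule small_diff)
    moreover have "peval h Y p \<in> K" using vars[OF p] Y K by (intro peval_mem) auto
    ultimately show ?thesis using subfield_small[OF K(1,3)] by simp
  qed
  have "\<forall>i\<in>I. \<exists>k\<ge>1. \<bar>X i - Y i\<bar> ^ k \<le> \<epsilon>" using moderate_small_power[OF mod Y(2)] by blast
  then obtain k where k: "\<And>i. i \<in> I \<Longrightarrow> k i \<ge> 1" "\<And>i. i \<in> I \<Longrightarrow> \<bar>X i - Y i\<bar> ^ k i \<le> \<epsilon>" by metis
  have "eventually (\<lambda>n. \<forall>p\<in>P. peval id (\<lambda>i. y i n) p = 0) ultra"
  proof (rule eventually_ball_finite[OF assms(2)], safe)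
    fix p assume "p \<in> P"
    then have "peval h (\<lambda>i. hyper_of (y i)) p = 0" using Y0 y by (simp add: y[symmetric])
    then show "eventually (\<lambda>n. peval id (\<lambda>i. y i n) p = 0) ultra"
      using peval_hyper_of[of "\<lambda>n i. y i n" p] h_def[abs_def, symmetric]
      by (simp add: hyper_of_ops hyper_of_eq)
  qed
  moreover have "eventually (\<lambda>n. \<forall>i\<in>I. \<bar>x n i - y i n\<bar> ^ k i \<le> e n) ultra"
  proof (rule eventually_ball_finite[OF assms(1)], safe)
    fix i assume "i \<in> I"
    from k(2)[OF this] show "eventually (\<lambda>n. \<bar>x n i - y i n\<bar> ^ k i \<le> e n) ultra"
      by (simp add: X_def y \<epsilon>_def hyper_of_ops hyper_of_power hyper_of_le)
  qed
  moreover have "eventually (\<lambda>n. \<forall>i\<in>I. k i \<le> Suc n) ultra"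
  proof (rule eventually_ball_finite[OF assms(1)], safe)
    fix i
    have "eventually (\<lambda>n. k i \<le> Suc n) sequentially" by (rule eventually_sequentiallyI[of "k i"]) simp
    then show "eventually (\<lambda>n. k i \<le> Suc n) ultra" using ultra_le filter_leD by blast
  qed
  moreover have "eventually (\<lambda>n. e n < 1) ultra" by (rule e_less) simp
  ultimately have "eventually (\<lambda>n. (\<forall>p\<in>P. peval id (\<lambda>i. y i n) p = 0) \<and>
      (\<forall>i\<in>I. \<bar>x n i - y i n\<bar> ^ k i \<le> e n) \<and> (\<forall>i\<in>I. k i \<le> Suc n) \<and> e n < 1) ultra"
    by (simp add: eventually_conj_iff)
  then obtain n where n: "\<And>p. p \<in> P \<Longrightarrow> peval id (\<lambda>i. y i n) p = 0"
      "\<And>i. i \<in> I \<Longrightarrow> \<bar>x n i - y i n\<bar> ^ k i \<le> e n" "\<And>i. i \<in> I \<Longrightarrow> k i \<le> Suc n" "e n < 1"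
    using eventually_happens'[OF ultra_nontrivial] by blast
  obtain i where i: "i \<in> I" "\<bar>x n i - y i n\<bar> > real (Suc n) * e n powr (1 / real (Suc n))"
    using bad[of "\<lambda>i. y i n" n] n(1) by blast
  have "\<bar>x n i - y i n\<bar> \<le> e n powr (1 / real (Suc n))"
    using n(2-4) i(1) k(1) by (intro le_powr_of_power_le[where k="k i"]) auto
  \<comment> \<open>The lifted point already satisfies the estimate with constant 1; the growing
    factor is pure slack.\<close>
  also have "\<dots> \<le> real (Suc n) * e n powr (1 / real (Suc n))"
    using mult_right_mono[of 1 "real (Suc n)" "e n powr (1 / real (Suc n))"] by simp
  finally show False using i(2) by simp
qed


section \<open>Gram factorization of positive semidefinite matrices\<close>

lemma mat_adjoint_index:
  assumes "(A :: complex mat) \<in> carrier_mat n m" "i < m" "j < n"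
  shows "mat_adjoint A $$ (i, j) = cnj (A $$ (j, i))"
  using assms unfolding mat_adjoint_def
  by (auto simp: mat_of_rows_index)

lemma mat_adjoint_carrier:
  "(A :: complex mat) \<in> carrier_mat n m \<Longrightarrow> mat_adjoint A \<in> carrier_mat m n"
  unfolding mat_adjoint_def by auto

lemma mult_cnj_nonneg: "0 \<le> z * cnj z"
  by (simp add: less_eq_complex_def)

lemma sum_rotate3:
  "(\<Sum>r\<in>A. \<Sum>s\<in>B. \<Sum>c\<in>C. g r s c) = (\<Sum>c\<in>C. \<Sum>r\<in>A. \<Sum>s\<in>B. g r s c)"
proof -
  have "(\<Sum>r\<in>A. \<Sum>s\<in>B. \<Sum>c\<in>C. g r s c) = (\<Sum>r\<in>A. \<Sum>c\<in>C. \<Sum>s\<in>B. g r s c)"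
    by (intro sum.cong refl sum.swap)
  also have "\<dots> = (\<Sum>c\<in>C. \<Sum>r\<in>A. \<Sum>s\<in>B. g r s c)" by (rule sum.swap)
  finally show ?thesis .
qed

text \<open>Matrix and vector are functions on all naturals of which only arguments below
  \<open>n\<close> matter, so the induction for the factorization needs no resizing.\<close>

definition quadratic_form :: "nat \<Rightarrow> (nat \<Rightarrow> nat \<Rightarrow> complex) \<Rightarrow> (nat \<Rightarrow> complex) \<Rightarrow> complex" where
  "quadratic_form n a f = (\<Sum>r<n. \<Sum>s<n. a r s * f s * cnj (f r))"

lemma psd_iff_quadratic_form:
  "psd n A \<longleftrightarrow> A \<in> carrier_mat n n \<and> (\<forall>r<n. \<forall>s<n. A $$ (r, s) = cnj (A $$ (s, r))) \<and>
    (\<forall>f. 0 \<le> quadratic_form n (\<lambda>r s. A $$ (r, s)) f)" (is "?L \<longleftrightarrow> ?R")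
proof (cases "A \<in> carrier_mat n n")
  case A: True
  have "(mat_adjoint A = A) \<longleftrightarrow> (\<forall>r<n. \<forall>s<n. A $$ (r, s) = cnj (A $$ (s, r)))"
  proof
    assume "mat_adjoint A = A"
    then show "\<forall>r<n. \<forall>s<n. A $$ (r, s) = cnj (A $$ (s, r))"
      using mat_adjoint_index[OF A] by metis
  next
    assume herm: "\<forall>r<n. \<forall>s<n. A $$ (r, s) = cnj (A $$ (s, r))"
    show "mat_adjoint A = A"
    proof (rule eq_matI)
      fix i j assume "i < dim_row A" "j < dim_col A"
      then have ij: "i < n" "j < n" using A by auto
      show "mat_adjoint A $$ (i, j) = A $$ (i, j)"
        unfolding mat_adjoint_index[OF A ij] using herm ij by metis
    qed (use A mat_adjoint_carrier[OF A] in auto)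
  qed
  moreover have q: "(A *\<^sub>v v) \<bullet>c v = quadratic_form n (\<lambda>r s. A $$ (r, s)) (\<lambda>i. v $ i)" if "v \<in> carrier_vec n" for v
    using A that unfolding quadratic_form_def
    by (auto simp: scalar_prod_def sum_distrib_right atLeast0LessThan intro!: sum.cong)
  have "(\<forall>v\<in>carrier_vec n. 0 \<le> (A *\<^sub>v v) \<bullet>c v) \<longleftrightarrow> (\<forall>f. 0 \<le> quadratic_form n (\<lambda>r s. A $$ (r, s)) f)"
  proof safe
    fix f assume "\<forall>v\<in>carrier_vec n. 0 \<le> (A *\<^sub>v v) \<bullet>c v"
    then have "0 \<le> (A *\<^sub>v vec n f) \<bullet>c vec n f" by simp
    then show "0 \<le> quadratic_form n (\<lambda>r s. A $$ (r, s)) f"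
      by (simp add: q) (simp add: quadratic_form_def)
  qed (simp add: q)
  ultimately show ?thesis using A by (simp add: psd_def)
qed (simp add: psd_def)

lemma quadratic_form_gram_nonneg:
  assumes "\<And>r s. r < n \<Longrightarrow> s < n \<Longrightarrow> a r s = (\<Sum>c\<in>S. b r c * cnj (b s c))"
  shows "0 \<le> quadratic_form n a f"
proof -
  have "quadratic_form n a f = (\<Sum>r<n. \<Sum>s<n. \<Sum>c\<in>S. (b r c * cnj (f r)) * cnj (b s c * cnj (f s)))"
    unfolding quadratic_form_def using assms
    by (auto intro!: sum.cong simp: sum_distrib_left sum_distrib_right mult_ac)
  also have "\<dots> = (\<Sum>c\<in>S. \<Sum>r<n. \<Sum>s<n. (b r c * cnj (f r)) * cnj (b s c * cnj (f s)))"
    by (rule sum_rotate3)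
  also have "\<dots> = (\<Sum>c\<in>S. (\<Sum>r<n. b r c * cnj (f r)) * cnj (\<Sum>r<n. b r c * cnj (f r)))"
    by (simp add: sum_product)
  also have "\<dots> \<ge> 0" by (intro sum_nonneg mult_cnj_nonneg)
  finally show ?thesis .
qed

text \<open>The column index set \<open>S\<close> is arbitrary: the images under Kraus maps come
  with more columns than rows.\<close>

lemma psd_gramI:
  assumes "A \<in> carrier_mat n n" "\<And>r s. r < n \<Longrightarrow> s < n \<Longrightarrow> A $$ (r, s) = (\<Sum>c\<in>S. b r c * cnj (b s c))"
  shows "psd n A"
  unfolding psd_iff_quadratic_form
proof (intro conjI allI impI)
  show "0 \<le> quadratic_form n (\<lambda>r s. A $$ (r, s)) f" for f
    by (rule quadratic_form_gram_nonneg) (use assms(2) in auto)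
qed (use assms in \<open>auto simp: mult.commute\<close>)

lemma quadratic_form_Suc:
  assumes herm: "\<And>r s. r \<le> n \<Longrightarrow> s \<le> n \<Longrightarrow> a r s = cnj (a s r)"
  defines "S \<equiv> (\<lambda>f. \<Sum>s<n. a n s * f s)"
  shows "quadratic_form (Suc n) a f = quadratic_form n a f + S f * cnj (f n) + cnj (S f) * f n
    + a n n * f n * cnj (f n)"
proof -
  have "cnj (S f) = (\<Sum>r<n. a r n * cnj (f r))"
    unfolding S_def by (simp, intro sum.cong refl) (use herm[of _ n] in auto)
  then show ?thesis
    by (simp add: quadratic_form_def sum.distrib S_def sum_distrib_left sum_distrib_right algebra_simps)
qed

text \<open>Induction on the last row and column. A zero last diagonal entry forces that row to
  vanish; a positive one is eliminated, leaving the Schur complement.\<close>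

lemma cholesky:
  assumes "\<And>r s. r < n \<Longrightarrow> s < n \<Longrightarrow> a r s = cnj (a s r)" "\<And>f. 0 \<le> quadratic_form n a f"
  shows "\<exists>b. \<forall>r<n. \<forall>s<n. a r s = (\<Sum>c<n. b r c * cnj (b s c))"
  using assms
proof (induction n arbitrary: a)
  case (Suc n)
  define S where "S f = (\<Sum>s<n. a n s * f s)" for f
  have herm: "\<And>r s. r \<le> n \<Longrightarrow> s \<le> n \<Longrightarrow> a r s = cnj (a s r)" by (rule Suc.prems(1)) auto
  note Q = quadratic_form_Suc[of n a, OF herm, folded S_def, simplified]
  have upd: "quadratic_form n a (f(n := x)) = quadratic_form n a f" "S (f(n := x)) = S f" for f x
    by (simp_all add: quadratic_form_def S_def)
  define d where "d = Re (a n n)"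
  have "Im (a n n) = 0" using arg_cong[OF herm[of n n], of Im] by simp
  then have d: "a n n = of_real d" by (simp add: d_def complex_eq_iff)
  have d0: "d \<ge> 0"
  proof -
    have "0 \<le> quadratic_form (Suc n) a ((\<lambda>_. 0)(n := 1))" by (rule Suc.prems(2))
    then show ?thesis unfolding Q upd by (simp add: d quadratic_form_def S_def less_eq_complex_def)
  qed
  show ?case
  proof (cases "d = 0")
    case True
    have z: "a n r = 0" if r: "r < n" for r
    proof (rule ccontr)
      assume nz: "a n r \<noteq> 0"
      \<comment> \<open>With \<open>d = 0\<close>, the vector with entry 1 at \<open>r\<close> and
        last entry \<open>- of_real t * a n r\<close> has form value \<open>a r r\<close> minus
        twice \<open>t\<close> times the squared modulus of \<open>a n r\<close>. This
        \<open>t\<close> makes it negative.\<close>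
      define t where "t = (cmod (a r r) + 1) / (cmod (a n r))\<^sup>2"
      define f where "f = (\<lambda>i. if i = r then 1 else 0 :: complex)"
      have Sf: "S f = a n r"
        unfolding S_def f_def using r by (simp add: if_distrib[of "\<lambda>x. _ * x"] cong: if_cong)
      have Qf: "quadratic_form n a f = a r r"
      proof -
        have "(\<Sum>s<n. a r' s * f s * cnj (f r')) = (if r' = r then a r r else 0)" for r'
          unfolding f_def using r by (simp add: if_distrib[of "\<lambda>x. _ * x"] cong: if_cong)
        then show ?thesis unfolding quadratic_form_def using r by simp
      qed
      have "0 \<le> quadratic_form (Suc n) a (f(n := - of_real t * a n r))" by (rule Suc.prems(2))
      then have "0 \<le> a r r - 2 * of_real t * (a n r * cnj (a n r))"
        unfolding Q upd by (simp add: Sf Qf d True algebra_simps)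
      then have "0 \<le> Re (a r r) - 2 * (t * (cmod (a n r))\<^sup>2)"
        by (simp add: less_eq_complex_def complex_norm_square[symmetric] mult.assoc)
      also have "t * (cmod (a n r))\<^sup>2 = cmod (a r r) + 1" using nz by (simp add: t_def)
      finally show False using complex_Re_le_cmod[of "a r r"] norm_ge_zero[of "a r r"] by argo
    qed
    have "\<exists>b. \<forall>r<n. \<forall>s<n. a r s = (\<Sum>c<n. b r c * cnj (b s c))"
    proof (rule Suc.IH)
      fix f
      have "0 \<le> quadratic_form (Suc n) a (f(n := 0))" by (rule Suc.prems(2))
      then show "0 \<le> quadratic_form n a f" unfolding Q upd by simp
    qed (rule Suc.prems(1), auto)
    then obtain b where b: "\<And>r s. r < n \<Longrightarrow> s < n \<Longrightarrow> a r s = (\<Sum>c<n. b r c * cnj (b s c))" by blast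
    have z': "a r n = 0" if "r < n" for r using z[OF that] herm[of r n] that by simp
    show ?thesis
    proof (intro exI[of _ "\<lambda>r c. if r < n \<and> c < n then b r c else 0"] allI impI)
      fix r s assume "r < Suc n" "s < Suc n"
      then show "a r s = (\<Sum>c<Suc n. (if r < n \<and> c < n then b r c else 0)
          * cnj (if s < n \<and> c < n then b s c else 0))"
        using b z z' d True by (cases "r < n"; cases "s < n") (auto simp: less_Suc_eq)
    qed
  next
    case False
    then have dpos: "d > 0" using d0 by simp
    \<comment> \<open>The Schur complement of the last diagonal entry.\<close>
    define a' where "a' r s = a r s - a r n * cnj (a s n) / of_real d" for r s
    have "\<exists>b. \<forall>r<n. \<forall>s<n. a' r s = (\<Sum>c<n. b r c * cnj (b s c))"
    proof (rule Suc.IH)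
      fix r s assume "r < n" "s < n"
      then show "a' r s = cnj (a' s r)" using herm[of r s] by (simp add: a'_def mult.commute)
    next
      fix f
      have cS: "cnj (S f) = (\<Sum>r<n. a r n * cnj (f r))"
        unfolding S_def by (simp, intro sum.cong refl) (use herm[of _ n] in auto)
      have S': "S f = (\<Sum>s<n. cnj (a s n) * f s)"
        unfolding S_def by (intro sum.cong refl) (use herm[of n] in auto)
      have "quadratic_form n a' f = quadratic_form n a f - cnj (S f) * S f / of_real d"
      proof -
        have "cnj (S f) * S f = (\<Sum>r<n. \<Sum>s<n. (a r n * cnj (f r)) * (cnj (a s n) * f s))"
          by (subst cS, subst S', rule sum_product)
        then show ?thesis
          by (simp add: quadratic_form_def a'_def algebra_simps sum_subtractf sum_divide_distrib)
      qed
      \<comment> \<open>The last coordinate is the minimizer of the full form for fixed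
        \<open>f\<close>, and the minimum is the form of the Schur complement.\<close>
      also have "\<dots> = quadratic_form (Suc n) a (f(n := - S f / of_real d))"
        unfolding Q upd using dpos by (simp add: d field_simps)
      also have "0 \<le> \<dots>" by (rule Suc.prems(2))
      finally show "0 \<le> quadratic_form n a' f" .
    qed
    then obtain b where b: "\<And>r s. r < n \<Longrightarrow> s < n \<Longrightarrow> a' r s = (\<Sum>c<n. b r c * cnj (b s c))" by blast
    have sq: "of_real (sqrt d) * of_real (sqrt d) = (of_real d :: complex)"
      using d0 by (simp flip: of_real_mult)
    show ?thesis
    proof (intro exI[of _ "\<lambda>r c. if c = n then a r n / of_real (sqrt d) else if r < n then b r c else 0"] allI impI)
      fix r s assume rs: "r < Suc n" "s < Suc n"
      have "(\<Sum>c<Suc n. (if c = n then a r n / of_real (sqrt d) else if r < n then b r c else 0)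
          * cnj (if c = n then a s n / of_real (sqrt d) else if s < n then b s c else 0))
        = (\<Sum>c<n. (if r < n then b r c else 0) * cnj (if s < n then b s c else 0))
          + a r n * cnj (a s n) / of_real d"
        by (simp add: sq)
      also have "\<dots> = a r s"
      proof (cases "r < n")
        case True
        then show ?thesis using rs d dpos
          by (cases "s < n") (auto simp: less_Suc_eq a'_def b[symmetric])
      next
        case False
        then have "r = n" using rs by simp
        then show ?thesis using rs d dpos herm[of n s]
          by (cases "s < n") (auto simp: less_Suc_eq)
      qed
      finally show "a r s = (\<Sum>c<Suc n. (if c = n then a r n / of_real (sqrt d) else if r < n then b r c else 0)
          * cnj (if c = n then a s n / of_real (sqrt d) else if s < n then b s c else 0))" ..
    qed
  qed
qed simp

lemma psd_gram:
  assumes "psd n A"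
  shows "\<exists>b. \<forall>r<n. \<forall>s<n. A $$ (r, s) = (\<Sum>c<n. b r c * cnj (b s c))"
  using assms unfolding psd_iff_quadratic_form by (intro cholesky) blast+


section \<open>Kraus form of one-qubit operations\<close>

text \<open>\<open>A l i a\<close> is the entry \<open>(i, a)\<close> of the \<open>l\<close>-th
  Kraus operator. Four operators suffice because the Choi matrix has size 4, and so its Gram factor
  has four columns.\<close>

definition kraus_map :: "(nat \<Rightarrow> nat \<Rightarrow> nat \<Rightarrow> complex) \<Rightarrow> complex mat \<Rightarrow> complex mat" where
  "kraus_map A X = mat 2 2 (\<lambda>(i, j).
     \<Sum>l<4. \<Sum>a<2. \<Sum>b<2. A l i a * X $$ (a, b) * cnj (A l j b))"

text \<open>The entry \<open>(b, a)\<close> of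
  \<open>\<Sum>\<^sub>l A\<^sub>l\<^sup>* A\<^sub>l - 1\<close>.\<close>

definition kraus_defect :: "(nat \<Rightarrow> nat \<Rightarrow> nat \<Rightarrow> complex) \<Rightarrow> nat \<Rightarrow> nat \<Rightarrow> complex" where
  "kraus_defect A a b = (\<Sum>l<4. \<Sum>i<2. A l i a * cnj (A l i b)) - (if a = b then 1 else 0)"

definition trace_preserving :: "(nat \<Rightarrow> nat \<Rightarrow> nat \<Rightarrow> complex) \<Rightarrow> bool" where
  "trace_preserving A \<longleftrightarrow> (\<forall>a<2. \<forall>b<2. kraus_defect A a b = 0)"

lemma kraus_map_carrier: "kraus_map A X \<in> carrier_mat 2 2"
  by (simp add: kraus_map_def)

lemma superoperator_kraus_map: "superoperator 2 (kraus_map A)"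
  unfolding superoperator_def
proof (intro conjI ballI allI)
  fix X Y :: "complex mat" assume "X \<in> carrier_mat 2 2" "Y \<in> carrier_mat 2 2"
  then show "kraus_map A (X + Y) = kraus_map A X + kraus_map A Y"
    by (intro eq_matI) (simp_all add: kraus_map_def sum.distrib ring_distribs)
next
  fix c and X :: "complex mat" assume "X \<in> carrier_mat 2 2"
  then show "kraus_map A (c \<cdot>\<^sub>m X) = c \<cdot>\<^sub>m kraus_map A X"
    by (intro eq_matI) (auto simp: kraus_map_def sum_distrib_left mult_ac intro!: sum.cong)
qed (rule kraus_map_carrier)

lemma sum_lessThan_add:
  "(\<Sum>r<k + M. g r) = (\<Sum>r<k. g r) + (\<Sum>m<M. g (k + m))" for M :: nat and g :: "nat \<Rightarrow> 'a::comm_monoid_add"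
  by (induction M) (simp_all add: add.assoc)

lemma sum_lessThan_mult:
  "(\<Sum>r<n * M. g r) = (\<Sum>i<n. \<Sum>m<M. g (i * M + m))" for M :: nat and g :: "nat \<Rightarrow> 'a::comm_monoid_add"
  by (induction n) (simp_all add: sum_lessThan_add add.commute[of M])

lemma cpso_kraus_map:
  assumes "trace_preserving A"
  shows "cpso 2 (kraus_map A)"
  unfolding cpso_def pso_def
proof (intro conjI allI impI)
  show "superoperator 2 (kraus_map A)" by (rule superoperator_kraus_map)
  then show "superoperator (2 * M) (tensor_id 2 M (kraus_map A))" for M by (rule superoperator_tensor_id)
  fix M \<rho> assume M: "0 < M" and \<rho>: "density (2 * M) \<rho>"
  then have psd: "psd (2 * M) \<rho>" and car: "\<rho> \<in> carrier_mat (2 * M) (2 * M)" and tr: "mtrace \<rho> = 1"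
    by (auto simp: density_def psd_def)
  from psd_gram[OF psd] obtain B where
    "\<forall>r<2 * M. \<forall>s<2 * M. \<rho> $$ (r, s) = (\<Sum>c<2 * M. B r c * cnj (B s c))"
    by (rule exE)
  then have B: "\<rho> $$ (r, s) = (\<Sum>c<2 * M. B r c * cnj (B s c))" if "r < 2 * M" "s < 2 * M" for r s
    using that by simp
  define T where "T = tensor_id 2 M (kraus_map A) \<rho>"
  have T: "T \<in> carrier_mat (2 * M) (2 * M)" by (simp add: T_def tensor_id_def)
  have Tent: "T $$ (r, s) = (\<Sum>l<4. \<Sum>a<2. \<Sum>b<2. A l (r div M) a *
      \<rho> $$ (a * M + r mod M, b * M + s mod M) * cnj (A l (s div M) b))" if "r < 2 * M" "s < 2 * M" for r s
    using that pair_index_bounds[OF that(1)] pair_index_bounds[OF that(2)]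
    by (simp add: T_def tensor_id_def kraus_map_def partial_block_def cong: sum.cong_simp)
  \<comment> \<open>If \<open>B\<close> is a Gram factor of the input, the columns of
    \<open>A\<^sub>l \<otimes> 1\<close> applied to \<open>B\<close>, over all \<open>l\<close>,
    form a Gram factor of the output.\<close>
  define D where "D r lc = (\<Sum>a<2. A (fst lc) (r div M) a * B (a * M + r mod M) (snd lc))" for r lc
  have "psd (2 * M) T"
  proof (rule psd_gramI[OF T, where S = "{..<4} \<times> {..<2 * M}"])
    fix r s assume rs: "r < 2 * M" "s < 2 * M"
    have "T $$ (r, s) = (\<Sum>l<4. \<Sum>a<2. \<Sum>b<2. \<Sum>c<2 * M. A l (r div M) a * B (a * M + r mod M) c *
      cnj (A l (s div M) b * B (b * M + s mod M) c))"
      unfolding Tent[OF rs] using M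
    proof (intro sum.cong refl)
      fix l a b :: nat assume "a \<in> {..<2}" "b \<in> {..<2}"
      then have "a * M + r mod M < 2 * M" "b * M + s mod M < 2 * M"
        using M by (auto intro!: pair_index_less)
      note B[OF this]
      then show "A l (r div M) a * \<rho> $$ (a * M + r mod M, b * M + s mod M) * cnj (A l (s div M) b)
        = (\<Sum>c<2 * M. A l (r div M) a * B (a * M + r mod M) c * cnj (A l (s div M) b * B (b * M + s mod M) c))"
        by (simp only: sum_distrib_left sum_distrib_right complex_cnj_mult mult_ac)
    qed
    also have "\<dots> = (\<Sum>l<4. \<Sum>c<2 * M. \<Sum>a<2. \<Sum>b<2. A l (r div M) a * B (a * M + r mod M) c *
      cnj (A l (s div M) b * B (b * M + s mod M) c))"
    proof (rule sum.cong[OF refl])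
      fix l :: nat
      show "(\<Sum>a<2. \<Sum>b<2. \<Sum>c<2 * M. A l (r div M) a * B (a * M + r mod M) c *
          cnj (A l (s div M) b * B (b * M + s mod M) c))
        = (\<Sum>c<2 * M. \<Sum>a<2. \<Sum>b<2. A l (r div M) a * B (a * M + r mod M) c *
          cnj (A l (s div M) b * B (b * M + s mod M) c))"
        by (rule sum_rotate3)
    qed
    also have "\<dots> = (\<Sum>l<4. \<Sum>c<2 * M. D r (l, c) * cnj (D s (l, c)))"
      unfolding D_def cnj_sum sum_product by simp
    also have "\<dots> = (\<Sum>lc\<in>{..<4} \<times> {..<2 * M}. D r lc * cnj (D s lc))"
      by (simp add: sum.cartesian_product case_prod_beta')
    finally show "T $$ (r, s) = (\<Sum>lc\<in>{..<4} \<times> {..<2 * M}. D r lc * cnj (D s lc))" .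
  qed
  moreover have "mtrace T = 1"
  proof -
    have "mtrace T = (\<Sum>i<2. \<Sum>m<M. T $$ (i * M + m, i * M + m))"
      unfolding mtrace_def carrier_matD(1)[OF T] by (rule sum_lessThan_mult)
    also have "\<dots> = (\<Sum>i<2. \<Sum>m<M. \<Sum>l<4. \<Sum>a<2. \<Sum>b<2. A l i a * \<rho> $$ (a * M + m, b * M + m) * cnj (A l i b))"
      by (intro sum.cong refl) (simp add: Tent pair_index_less)
    also have "\<dots> = (\<Sum>i<2. \<Sum>m<M. \<Sum>a<2. \<Sum>b<2. \<Sum>l<4. \<rho> $$ (a * M + m, b * M + m) * (A l i a * cnj (A l i b)))"
      by (simp add: sum.distrib numeral_eq_Suc mult_ac add_ac)
    also have "\<dots> = (\<Sum>m<M. \<Sum>a<2. \<Sum>b<2. \<Sum>l<4. \<Sum>i<2. \<rho> $$ (a * M + m, b * M + m) * (A l i a * cnj (A l i b)))"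
      by (simp add: sum.distrib numeral_eq_Suc add_ac)
    also have "\<dots> = (\<Sum>m<M. \<Sum>a<2. \<Sum>b<2. \<rho> $$ (a * M + m, b * M + m) * (\<Sum>l<4. \<Sum>i<2. A l i a * cnj (A l i b)))"
      by (simp only: sum_distrib_left)
    also have "\<dots> = (\<Sum>m<M. \<Sum>a<2. \<Sum>b<2. \<rho> $$ (a * M + m, b * M + m) * (if a = b then 1 else 0))"
      using assms by (intro sum.cong refl) (auto simp: trace_preserving_def kraus_defect_def)
    also have "\<dots> = (\<Sum>i<2. \<Sum>m<M. \<rho> $$ (i * M + m, i * M + m))"
      by (simp add: numeral_eq_Suc sum.distrib)
    also have "\<dots> = mtrace \<rho>"
      unfolding mtrace_def carrier_matD(1)[OF car] by (rule sum_lessThan_mult[symmetric])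
    finally show ?thesis using tr by simp
  qed
  ultimately show "density (2 * M) (tensor_id 2 M (kraus_map A) \<rho>)" by (simp add: density_def T_def)
qed


lemma funpow_kraus_map:
  assumes G: "\<And>X. X \<in> carrier_mat 2 2 \<Longrightarrow> G X = kraus_map A X" and X: "X \<in> carrier_mat 2 2"
  shows "(G ^^ k) X = (kraus_map A ^^ k) X" "(kraus_map A ^^ k) X \<in> carrier_mat 2 2"
proof -
  have "(G ^^ k) X = (kraus_map A ^^ k) X \<and> (kraus_map A ^^ k) X \<in> carrier_mat 2 2"
    by (induction k) (auto simp: X G kraus_map_carrier)
  then show "(G ^^ k) X = (kraus_map A ^^ k) X" "(kraus_map A ^^ k) X \<in> carrier_mat 2 2" by auto
qed

section \<open>From CPSOs to Kraus operators\<close>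

definition mat_unit :: "nat \<Rightarrow> nat \<Rightarrow> complex mat" where
  "mat_unit a b = mat 2 2 (\<lambda>(i, j). if i = a \<and> j = b then 1 else 0)"

lemma mat_unit_carrier: "mat_unit a b \<in> carrier_mat 2 2" by (simp add: mat_unit_def)

lemma nat_less_2_iff: "(i::nat) < 2 \<longleftrightarrow> i = 0 \<or> i = 1" by auto

lemma mat_unit_expand:
  assumes "X \<in> carrier_mat 2 2"
  shows "X = X $$ (0,0) \<cdot>\<^sub>m mat_unit 0 0 + X $$ (0,1) \<cdot>\<^sub>m mat_unit 0 1
    + X $$ (1,0) \<cdot>\<^sub>m mat_unit 1 0 + X $$ (1,1) \<cdot>\<^sub>m mat_unit 1 1"
  using assms by (intro eq_matI) (auto simp: mat_unit_def nat_less_2_iff)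

lemma superoperator_expand:
  assumes G: "superoperator 2 G" and X: "X \<in> carrier_mat 2 2"
  shows "G X = X $$ (0,0) \<cdot>\<^sub>m G (mat_unit 0 0) + X $$ (0,1) \<cdot>\<^sub>m G (mat_unit 0 1)
    + X $$ (1,0) \<cdot>\<^sub>m G (mat_unit 1 0) + X $$ (1,1) \<cdot>\<^sub>m G (mat_unit 1 1)"
proof -
  have add: "\<And>U V. U \<in> carrier_mat 2 2 \<Longrightarrow> V \<in> carrier_mat 2 2 \<Longrightarrow> G (U + V) = G U + G V"
    and smult: "\<And>c U. U \<in> carrier_mat 2 2 \<Longrightarrow> G (c \<cdot>\<^sub>m U) = c \<cdot>\<^sub>m G U"
    using G by (auto simp: superoperator_def)
  show ?thesis
    by (subst mat_unit_expand[OF X]) (simp add: add smult mat_unit_carrier)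
qed

lemma superoperator_carrier: "superoperator n G \<Longrightarrow> X \<in> carrier_mat n n \<Longrightarrow> G X \<in> carrier_mat n n"
  by (simp add: superoperator_def)

lemma sum_lessThan_2: "(\<Sum>a<2. f a) = f 0 + f 1" for f :: "nat \<Rightarrow> 'a::comm_monoid_add"
  by (simp add: numeral_2_eq_2)

lemma superoperator_index:
  assumes G: "superoperator 2 G" and X: "X \<in> carrier_mat 2 2" and ij: "i < 2" "j < 2"
  shows "G X $$ (i, j) = (\<Sum>a<2. \<Sum>b<2. X $$ (a, b) * G (mat_unit a b) $$ (i, j))"
proof -
  have "dim_row (G (mat_unit a b)) = 2" "dim_col (G (mat_unit a b)) = 2" for a b
    using superoperator_carrier[OF G mat_unit_carrier, of a b] by auto
  then show ?thesis
    using ij by (subst superoperator_expand[OF G X]) (simp add: sum_lessThan_2 add.assoc)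
qed

lemma mtrace_2: "X \<in> carrier_mat 2 2 \<Longrightarrow> mtrace X = X $$ (0,0) + X $$ (1,1)"
  by (simp add: mtrace_def numeral_2_eq_2)

lemma density_2_gram1I:
  assumes "X = mat 2 2 (\<lambda>(r, s). v r * cnj (v s))" "v 0 * cnj (v 0) + v 1 * cnj (v 1) = 1"
  shows "density 2 X"
proof -
  have "psd 2 X" by (rule psd_gramI[where S = "{0 :: nat}" and b = "\<lambda>r _. v r"]) (auto simp: assms(1))
  moreover have "mtrace X = 1" using assms by (simp add: mtrace_2)
  ultimately show ?thesis by (simp add: density_def)
qed

lemma cpso_mtrace:
  assumes G: "cpso 2 G" and \<rho>: "density 2 \<rho>"
  shows "mtrace (G \<rho>) = 1"
proof -
  have S: "superoperator 2 G" and car: "\<rho> \<in> carrier_mat 2 2"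
    using G \<rho> by (auto simp: cpso_def density_def psd_def)
  have M: "\<forall>M>0. pso (2 * M) (tensor_id 2 M G)" using G unfolding cpso_def by (rule conjunct2)
  \<comment> \<open>For \<open>M = 1\<close> the tensor product is \<open>G\<close> itself.\<close>
  have "pso (2 * 1) (tensor_id 2 1 G)" by (rule M[rule_format]) simp
  then have "density 2 (tensor_id 2 1 G \<rho>)" using \<rho> by (simp add: pso_def)
  moreover have "partial_block 2 1 0 0 \<rho> = \<rho>" using car by (intro eq_matI) (auto simp: partial_block_def)
  then have "tensor_id 2 1 G \<rho> = G \<rho>" using superoperator_carrier[OF S car]
    by (intro eq_matI) (auto simp: tensor_id_def)
  ultimately show ?thesis by (simp add: density_def)
qed

text \<open>Trace preservation is given on density matrices only. Polarization with the two basis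
  states and the normalized sums of the first basis vector with 1 and \<open>\<i>\<close> times the
  second extends it to the off-diagonal units.\<close>

lemma cpso_mtrace_mat_unit:
  assumes G: "cpso 2 G" and "a < 2" "b < 2"
  shows "mtrace (G (mat_unit a b)) = (if a = b then 1 else 0)"
proof -
  have S: "superoperator 2 G" using G by (simp add: cpso_def)
  define t where "t a b = mtrace (G (mat_unit a b))" for a b
  have lin: "mtrace (G X) = (\<Sum>a<2. \<Sum>b<2. X $$ (a, b) * t a b)" if X: "X \<in> carrier_mat 2 2" for X
    unfolding t_def mtrace_2[OF superoperator_carrier[OF S X]]
      mtrace_2[OF superoperator_carrier[OF S mat_unit_carrier]]
    by (simp add: superoperator_index[OF S X] numeral_2_eq_2 algebra_simps)
  have v: "(\<Sum>a<2. \<Sum>b<2. v a * cnj (v b) * t a b) = 1" if "v 0 * cnj (v 0) + v 1 * cnj (v 1) = 1" for v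
  proof -
    define X where "X = mat 2 2 (\<lambda>(r, s). v r * cnj (v s))"
    have "X \<in> carrier_mat 2 2" by (simp add: X_def)
    have "1 = mtrace (G X)" using cpso_mtrace[OF G density_2_gram1I[OF X_def that]] by simp
    also have "\<dots> = (\<Sum>a<2. \<Sum>b<2. v a * cnj (v b) * t a b)"
      unfolding lin[OF \<open>X \<in> carrier_mat 2 2\<close>] by (intro sum.cong refl) (simp add: X_def)
    finally show ?thesis by simp
  qed
  define h :: complex where "h = of_real (sqrt (1/2))"
  have h: "h * h = 1/2" "cnj h = h" by (simp_all add: h_def flip: of_real_mult)
  have t00: "t 0 0 = 1" and t11: "t 1 1 = 1"
    using v[of "\<lambda>r. if r = 0 then 1 else 0"] v[of "\<lambda>r. if r = 1 then 1 else 0"]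
    by (simp_all add: numeral_2_eq_2)
  have "(h * h) * (t 0 0 + t 0 1 + t 1 0 + t 1 1) = 1"
  proof -
    have "(\<Sum>a<2. \<Sum>b<2. h * cnj h * t a b) = 1" by (rule v) (simp add: h)
    then show ?thesis by (simp add: sum_lessThan_2 h(2) algebra_simps)
  qed
  then have 1: "t 0 1 + t 1 0 = 0" unfolding h t00 t11 by (simp add: field_simps)
  have "(h * h) * (t 0 0 - \<i> * t 0 1 + \<i> * t 1 0 + t 1 1) = 1"
  proof -
    define w where "w r = (if r = 0 then h else \<i> * h)" for r :: nat
    have w: "w 0 = h" "w 1 = \<i> * h" "w (Suc 0) = \<i> * h" by (simp_all add: w_def)
    have "(\<Sum>a<2. \<Sum>b<2. w a * cnj (w b) * t a b) = 1"
    proof (rule v)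
      have "w 0 * cnj (w 0) = h * h" "w 1 * cnj (w 1) = h * h" by (simp_all add: w h(2) algebra_simps)
      then show "w 0 * cnj (w 0) + w 1 * cnj (w 1) = 1" by (simp only: h(1)) simp
    qed
    then show ?thesis by (simp add: sum_lessThan_2 w h(2) algebra_simps)
  qed
  then have 2: "\<i> * t 1 0 - \<i> * t 0 1 = 0" unfolding h t00 t11 by (simp add: field_simps)
  then have "t 1 0 = t 0 1" by simp
  then have "t 0 1 = 0" "t 1 0 = 0" using 1 by auto
  then show ?thesis using t00 t11 assms(2,3) by (auto simp: t_def nat_less_2_iff)
qed

text \<open>Choi's argument with \<open>M = 2\<close>: the image of the maximally entangled state is
  positive semidefinite, and the columns of its Gram factor, reshaped to two-by-two matrices, are
  the Kraus operators.\<close>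

theorem cpso_kraus:
  assumes G: "cpso 2 G"
  shows "\<exists>A. trace_preserving A \<and> (\<forall>X\<in>carrier_mat 2 2. G X = kraus_map A X)"
proof -
  have S: "superoperator 2 G" using G by (simp add: cpso_def)
  define h :: complex where "h = of_real (sqrt (1/2))"
  have h: "h * h = 1/2" "cnj h = h" by (simp_all add: h_def flip: of_real_mult)
  \<comment> \<open>The indices 0 and 3 encode the pairs (0,0) and (1,1); \<open>v\<close> is the
    normalized maximally entangled vector.\<close>
  define v where "v r = (if r = 0 \<or> r = 3 then h else 0)" for r :: nat
  define \<rho> where "\<rho> = mat 4 4 (\<lambda>(r, s). v r * cnj (v s))"
  have car: "\<rho> \<in> carrier_mat 4 4" by (simp add: \<rho>_def)
  have "psd 4 \<rho>"
    by (rule psd_gramI[where S = "{0 :: nat}" and b = "\<lambda>r _. v r"]) (auto simp: \<rho>_def)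
  moreover have "mtrace \<rho> = 1"
  proof -
    have "mtrace \<rho> = h * h + h * h" by (simp add: mtrace_def \<rho>_def v_def numeral_eq_Suc h(2))
    then show ?thesis by (simp add: h)
  qed
  ultimately have "density (2 * 2) \<rho>" by (simp add: density_def)
  moreover have M: "\<forall>M>0. pso (2 * M) (tensor_id 2 M G)" using G unfolding cpso_def by (rule conjunct2)
  have "pso (2 * 2) (tensor_id 2 2 G)" by (rule M[rule_format]) simp
  ultimately have "psd 4 (tensor_id 2 2 G \<rho>)" by (simp add: pso_def density_def)
  from psd_gram[OF this] obtain B where
    "\<forall>r<4. \<forall>s<4. tensor_id 2 2 G \<rho> $$ (r, s) = (\<Sum>c<(4::nat). B r c * cnj (B s c))"
    by (rule exE)
  then have B: "tensor_id 2 2 G \<rho> $$ (r, s) = (\<Sum>c<4. B r c * cnj (B s c))" if "r < 4" "s < 4" for r s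
    using that by simp
  have block: "partial_block 2 2 a b \<rho> = (1/2) \<cdot>\<^sub>m mat_unit a b" if "a < 2" "b < 2" for a b
    using that h by (intro eq_matI) (auto simp: partial_block_def \<rho>_def mat_unit_def v_def nat_less_2_iff)
  have ent: "G (mat_unit a b) $$ (i, j) = 2 * (\<Sum>c<4. B (i * 2 + a) c * cnj (B (j * 2 + b) c))"
    if "a < 2" "b < 2" "i < 2" "j < 2" for a b i j
  proof -
    have "(\<Sum>c<4. B (i * 2 + a) c * cnj (B (j * 2 + b) c)) = tensor_id 2 2 G \<rho> $$ (i * 2 + a, j * 2 + b)"
      using that by (intro B[symmetric]) auto
    also have "\<dots> = G (partial_block 2 2 a b \<rho>) $$ (i, j)"
      using that by (simp add: tensor_id_def)
    also have "G (partial_block 2 2 a b \<rho>) = (1/2) \<cdot>\<^sub>m G (mat_unit a b)"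
      unfolding block[OF that(1,2)] using S mat_unit_carrier by (simp only: superoperator_def)
    finally show ?thesis using superoperator_carrier[OF S mat_unit_carrier, of a b] that by (simp add: mult.commute)
  qed
  define q :: complex where "q = of_real (sqrt 2)"
  have q: "q * q = 2" "cnj q = q" by (simp_all add: q_def flip: of_real_mult)
  \<comment> \<open>The factor \<open>q\<close>, a square root of 2, undoes the 1/2 in the blocks of
    the entangled state.\<close>
  define A where "A l i a = q * B (i * 2 + a) l" for l i a
  have ent': "G (mat_unit a b) $$ (i, j) = (\<Sum>l<4. A l i a * cnj (A l j b))"
    if "a < 2" "b < 2" "i < 2" "j < 2" for a b i j
  proof -
    have "(\<Sum>l<4. A l i a * cnj (A l j b)) = (\<Sum>l<4. (q * q) * (B (i * 2 + a) l * cnj (B (j * 2 + b) l)))"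
      by (simp add: A_def q(2) mult_ac)
    then show ?thesis unfolding ent[OF that] q sum_distrib_left by simp
  qed
  have "G X = kraus_map A X" if X: "X \<in> carrier_mat 2 2" for X
  proof (rule eq_matI)
    fix i j assume "i < dim_row (kraus_map A X)" "j < dim_col (kraus_map A X)"
    then have ij: "i < 2" "j < 2" by (auto simp: kraus_map_def)
    have "G X $$ (i, j) = (\<Sum>a<2. \<Sum>b<2. \<Sum>l<4. A l i a * X $$ (a, b) * cnj (A l j b))"
      unfolding superoperator_index[OF S X ij]
      by (intro sum.cong refl) (use ij in \<open>simp add: ent' sum_distrib_left mult_ac\<close>)
    also have "\<dots> = (\<Sum>l<4. \<Sum>a<2. \<Sum>b<2. A l i a * X $$ (a, b) * cnj (A l j b))"
      by (rule sum_rotate3)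
    also have "\<dots> = kraus_map A X $$ (i, j)" using ij by (simp add: kraus_map_def)
    finally show "G X $$ (i, j) = kraus_map A X $$ (i, j)" .
  qed (use superoperator_carrier[OF S X] in \<open>auto simp: kraus_map_def\<close>)
  moreover have "trace_preserving A"
    unfolding trace_preserving_def kraus_defect_def
  proof (intro allI impI)
    fix a b :: nat assume ab: "a < 2" "b < 2"
    have "(\<Sum>l<4. \<Sum>i<2. A l i a * cnj (A l i b)) = (\<Sum>i<2. \<Sum>l<4. A l i a * cnj (A l i b))"
      by (rule sum.swap)
    also have "\<dots> = (\<Sum>i<2. G (mat_unit a b) $$ (i, i))" using ab by (simp add: ent')
    also have "\<dots> = mtrace (G (mat_unit a b))"
      using superoperator_carrier[OF S mat_unit_carrier, of a b] by (simp add: mtrace_def)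
    finally show "(\<Sum>l<4. \<Sum>i<2. A l i a * cnj (A l i b)) - (if a = b then 1 else 0) = 0"
      using cpso_mtrace_mat_unit[OF G ab] by simp
  qed
  ultimately show ?thesis by blast
qed

lemma trace_preserving_bound:
  assumes "trace_preserving A" "l < 4" "i < 2" "a < 2"
  shows "cmod (A l i a) \<le> 1"
proof -
  have "(\<Sum>l<4. \<Sum>i<2. A l i a * cnj (A l i a)) = 1"
    using assms by (simp add: trace_preserving_def kraus_defect_def)
  then have "Re (\<Sum>l<4. \<Sum>i<2. A l i a * cnj (A l i a)) = 1" by simp
  then have 1: "(\<Sum>l<4. \<Sum>i<2. (cmod (A l i a))\<^sup>2) = 1"
    by (simp add: complex_norm_square[symmetric] flip: of_real_power)
  have "(cmod (A l i a))\<^sup>2 \<le> (\<Sum>i<2. (cmod (A l i a))\<^sup>2)"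
    using assms(3) by (intro member_le_sum) auto
  also have "\<dots> \<le> (\<Sum>l<4. \<Sum>i<2. (cmod (A l i a))\<^sup>2)"
    using assms(2) by (intro member_le_sum[of l _ "\<lambda>l. \<Sum>i<2. (cmod (A l i a))\<^sup>2"]) (auto intro: sum_nonneg)
  finally show ?thesis using 1 by (simp add: abs_square_le_1)
qed


section \<open>The trace norm of a two-by-two matrix\<close>

text \<open>Keeps the index \<open>1\<close> from being rewritten to \<open>Suc 0\<close>, so that
  facts about single matrix entries match.\<close>

declare One_nat_def [simp del]

text \<open>The sum of the squared singular values. As \<open>cmod (det2 V)\<close> is their
  product, \<open>frob_sq V + 2 * cmod (det2 V)\<close> is the square of their sum, the trace
  norm.\<close>

definition frob_sq :: "complex mat \<Rightarrow> real" where
  "frob_sq V = (cmod (V $$ (0,0)))\<^sup>2 + (cmod (V $$ (0,1)))\<^sup>2 + (cmod (V $$ (1,0)))\<^sup>2 + (cmod (V $$ (1,1)))\<^sup>2"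

definition det2 :: "complex mat \<Rightarrow> complex" where
  "det2 V = V $$ (0,0) * V $$ (1,1) - V $$ (0,1) * V $$ (1,0)"

lemma mult_index_2:
  assumes "A \<in> carrier_mat 2 2" "B \<in> carrier_mat 2 2" "i < 2" "j < 2"
  shows "(A * B) $$ (i, j) = A $$ (i, 0) * B $$ (0, j) + A $$ (i, 1) * B $$ (1, j)"
  using assms by (simp add: scalar_prod_def numeral_2_eq_2 One_nat_def)

lemma eq_mat_2I:
  assumes "A \<in> carrier_mat 2 2" "B \<in> carrier_mat 2 2"
    "A $$ (0,0) = B $$ (0,0)" "A $$ (0,1) = B $$ (0,1)" "A $$ (1,0) = B $$ (1,0)" "A $$ (1,1) = B $$ (1,1)"
  shows "A = B"
  using assms by (intro eq_matI) (auto simp: nat_less_2_iff)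

lemma psd_2_entries:
  assumes "psd 2 P"
  obtains p q w where "p \<ge> 0" "q \<ge> 0" "(cmod w)\<^sup>2 \<le> p * q"
    "P $$ (0,0) = of_real p" "P $$ (1,1) = of_real q" "P $$ (0,1) = w" "P $$ (1,0) = cnj w"
proof -
  from psd_gram[OF assms] obtain b where
    "\<forall>r<2. \<forall>s<2. P $$ (r, s) = (\<Sum>c<(2::nat). b r c * cnj (b s c))"
    by (rule exE)
  then have b: "P $$ (r, s) = b r 0 * cnj (b s 0) + b r 1 * cnj (b s 1)" if "r < 2" "s < 2" for r s
    using that by (simp add: sum_lessThan_2)
  define p where "p = (cmod (b 0 0))\<^sup>2 + (cmod (b 0 1))\<^sup>2"
  define q where "q = (cmod (b 1 0))\<^sup>2 + (cmod (b 1 1))\<^sup>2"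
  define w where "w = b 0 0 * cnj (b 1 0) + b 0 1 * cnj (b 1 1)"
  \<comment> \<open>The determinant of the Gram factor; its squared modulus is the determinant of
    \<open>P\<close>.\<close>
  define e where "e = b 0 0 * b 1 1 - b 0 1 * b 1 0"
  have p: "P $$ (0,0) = of_real p" and q: "P $$ (1,1) = of_real q"
    by (simp_all add: b p_def q_def complex_norm_square del: of_real_power)
  have w: "P $$ (0,1) = w" "P $$ (1,0) = cnj w" by (simp_all add: b w_def mult.commute)
  have "complex_of_real (p * q - (cmod w)\<^sup>2) = of_real ((cmod e)\<^sup>2)"
    unfolding of_real_diff of_real_mult complex_norm_square p_def q_def of_real_add
    by (simp add: w_def e_def algebra_simps)
  then have "p * q - (cmod w)\<^sup>2 = (cmod e)\<^sup>2" unfolding of_real_eq_iff .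
  then have "(cmod w)\<^sup>2 \<le> p * q" using zero_le_power2[of "cmod e"] by linarith
  then show ?thesis using p q w by (intro that[of p q w]) (auto simp: p_def q_def)
qed

lemma gram_carrier: "(V :: complex mat) \<in> carrier_mat 2 2 \<Longrightarrow> mat_adjoint V * V \<in> carrier_mat 2 2"
  by (intro mult_carrier_mat[of _ 2 2] mat_adjoint_carrier)

lemma gram_index:
  assumes V: "(V :: complex mat) \<in> carrier_mat 2 2" and ij: "i < 2" "j < 2"
  shows "(mat_adjoint V * V) $$ (i, j) = cnj (V $$ (0, i)) * V $$ (0, j) + cnj (V $$ (1, i)) * V $$ (1, j)"
  using mult_index_2[OF mat_adjoint_carrier[OF V] V ij] ij by (simp add: mat_adjoint_index[OF V])

text \<open>Cayley-Hamilton for \<open>P\<close>: its square plus its determinant is its trace times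
  \<open>P\<close>, and the determinant equals \<open>cmod (det2 V)\<close>. Trace and then
  \<open>P\<close> are thus determined by \<open>V\<close>, which yields uniqueness of the
  root.\<close>

lemma psd_root_trace:
  assumes V: "V \<in> carrier_mat 2 2" and P: "psd 2 P" "P * P = mat_adjoint V * V"
  shows "mtrace P = of_real (sqrt (frob_sq V + 2 * cmod (det2 V)))"
    and "mtrace P \<cdot>\<^sub>m P = mat_adjoint V * V + of_real (cmod (det2 V)) \<cdot>\<^sub>m 1\<^sub>m 2"
    and "mtrace P = 0 \<Longrightarrow> P = 0\<^sub>m 2 2"
proof -
  have car: "P \<in> carrier_mat 2 2" using P by (simp add: psd_def)
  obtain p q w where pq: "p \<ge> 0" "q \<ge> 0" "(cmod w)\<^sup>2 \<le> p * q"
    "P $$ (0,0) = of_real p" "P $$ (1,1) = of_real q" "P $$ (0,1) = w" "P $$ (1,0) = cnj w"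
    using psd_2_entries[OF P(1)] .
  have tr: "mtrace P = of_real (p + q)" using car pq by (simp add: mtrace_2)
  have ww: "w * cnj w = of_real ((cmod w)\<^sup>2)" by (rule complex_norm_square[symmetric])
  then have ww': "cnj w * w = of_real ((cmod w)\<^sup>2)" by (simp add: mult.commute)
  have PP: "(P * P) $$ (0,0) = of_real (p * p + (cmod w)\<^sup>2)" "(P * P) $$ (0,1) = of_real (p + q) * w"
    "(P * P) $$ (1,0) = of_real (p + q) * cnj w" "(P * P) $$ (1,1) = of_real (q * q + (cmod w)\<^sup>2)"
    by (simp_all add: mult_index_2[OF car car] pq ww ww' algebra_simps)
  note VV = gram_index[OF V, of 0 0] gram_index[OF V, of 0 1] gram_index[OF V, of 1 0] gram_index[OF V, of 1 1]
  have fr: "frob_sq V = p * p + q * q + 2 * (cmod w)\<^sup>2"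
  proof -
    have "complex_of_real (frob_sq V) = (P * P) $$ (0,0) + (P * P) $$ (1,1)"
      unfolding P(2) frob_sq_def of_real_add complex_norm_square using VV by (simp add: mult.commute)
    also have "\<dots> = of_real (p * p + q * q + 2 * (cmod w)\<^sup>2)" unfolding PP by simp
    finally show ?thesis unfolding of_real_eq_iff .
  qed
  define d where "d = p * q - (cmod w)\<^sup>2"
  have d0: "d \<ge> 0" using pq by (simp add: d_def)
  have "complex_of_real ((cmod (det2 V))\<^sup>2) = det2 (mat_adjoint V * V)"
    unfolding complex_norm_square using VV by (simp add: det2_def algebra_simps)
  also have "\<dots> = det2 (P * P)" unfolding P(2) ..
  also have "\<dots> = of_real (p * p + (cmod w)\<^sup>2) * of_real (q * q + (cmod w)\<^sup>2) - of_real (p + q) * of_real (p + q) * (w * cnj w)"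
    unfolding det2_def PP by (simp add: mult_ac)
  also have "\<dots> = of_real (d\<^sup>2)"
    unfolding ww by (simp add: d_def power2_eq_square algebra_simps flip: of_real_mult of_real_add of_real_diff)
  finally have "(cmod (det2 V))\<^sup>2 = d\<^sup>2" unfolding of_real_eq_iff .
  then have det: "cmod (det2 V) = d" using d0 by (simp add: power2_eq_iff_nonneg)
  have "frob_sq V + 2 * cmod (det2 V) = (p + q)\<^sup>2"
    unfolding fr det by (simp add: d_def power2_eq_square algebra_simps)
  then show "mtrace P = of_real (sqrt (frob_sq V + 2 * cmod (det2 V)))"
    using pq unfolding tr by simp
  show "mtrace P \<cdot>\<^sub>m P = mat_adjoint V * V + of_real (cmod (det2 V)) \<cdot>\<^sub>m 1\<^sub>m 2"
    unfolding P(2)[symmetric] det tr using car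
  proof (intro eq_mat_2I)
  qed (auto simp: PP pq d_def algebra_simps simp del: index_mult_mat(1))
  show "P = 0\<^sub>m 2 2" if "mtrace P = 0"
  proof -
    have "p + q = 0" using that unfolding tr of_real_eq_0_iff .
    then have "p = 0" "q = 0" using pq by linarith+
    moreover from this have "w = 0" using pq(3) by simp
    ultimately show ?thesis using car pq by (intro eq_mat_2I) auto
  qed
qed

lemma psd_root_unique:
  assumes V: "V \<in> carrier_mat 2 2" and P: "psd 2 P" "P * P = mat_adjoint V * V"
    and Q: "psd 2 Q" "Q * Q = mat_adjoint V * V"
  shows "P = Q"
proof (cases "mtrace P = 0")
  case True
  moreover have "mtrace Q = 0" using True psd_root_trace(1)[OF V P] psd_root_trace(1)[OF V Q] by simp
  ultimately show ?thesis using psd_root_trace(3)[OF V P] psd_root_trace(3)[OF V Q] by simp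
next
  case False
  have car: "P \<in> carrier_mat 2 2" "Q \<in> carrier_mat 2 2" using P Q by (auto simp: psd_def)
  have "mtrace P \<cdot>\<^sub>m P = mtrace P \<cdot>\<^sub>m Q"
    using psd_root_trace(1,2)[OF V P] psd_root_trace(1,2)[OF V Q] by simp
  then have "(mtrace P \<cdot>\<^sub>m P) $$ (i, j) = (mtrace P \<cdot>\<^sub>m Q) $$ (i, j)" for i j by simp
  then have "P $$ (i, j) = Q $$ (i, j)" if "i < 2" "j < 2" for i j using car that False
    by (metis carrier_matD index_smult_mat(1) mult_cancel_left)
  then show ?thesis using car by (intro eq_matI) auto
qed

lemma psd_root_exists:
  assumes V: "V \<in> carrier_mat 2 2"
  shows "\<exists>P. psd 2 P \<and> P * P = mat_adjoint V * V"
proof -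
  define d where "d = cmod (det2 V)"
  define t where "t = sqrt (frob_sq V + 2 * d)"
  have nn: "frob_sq V \<ge> 0" "d \<ge> 0" by (simp_all add: frob_sq_def d_def)
  have t2: "t * t = frob_sq V + 2 * d" using nn by (simp add: t_def)
  define W where "W = mat_adjoint V * V"
  have W: "W \<in> carrier_mat 2 2" unfolding W_def by (rule gram_carrier[OF V])
  note VV = gram_index[OF V, of 0 0, folded W_def] gram_index[OF V, of 0 1, folded W_def]
    gram_index[OF V, of 1 0, folded W_def] gram_index[OF V, of 1 1, folded W_def]
  have trW: "of_real (frob_sq V) = W $$ (0,0) + W $$ (1,1)"
    unfolding frob_sq_def of_real_add complex_norm_square using VV by (simp add: mult.commute)
  have dW: "of_real (d * d) = W $$ (0,0) * W $$ (1,1) - W $$ (0,1) * W $$ (1,0)"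
    unfolding d_def power2_eq_square[symmetric] complex_norm_square using VV
    by (simp add: det2_def algebra_simps)
  show ?thesis
  proof (cases "t = 0")
    case True
    then have "frob_sq V = 0" using t2 nn by simp
    then have "V $$ (0,0) = 0" "V $$ (0,1) = 0" "V $$ (1,0) = 0" "V $$ (1,1) = 0"
      by (simp_all add: frob_sq_def add_nonneg_eq_0_iff)
    then have "W = 0\<^sub>m 2 2" using W VV by (intro eq_mat_2I) auto
    moreover have "psd 2 (0\<^sub>m 2 2)" by (rule psd_gramI[where S = "{} :: nat set"]) auto
    ultimately show ?thesis unfolding W_def[symmetric] by (intro exI[of _ "0\<^sub>m 2 2"]) auto
  next
    case False
    have tpos: "t > 0" using False t2 nn by (simp add: t_def)
    \<comment> \<open>Cayley-Hamilton solved for the root, with \<open>t\<close> its trace and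
      \<open>d\<close> its determinant.\<close>
    define P where "P = of_real (1 / t) \<cdot>\<^sub>m (W + of_real d \<cdot>\<^sub>m 1\<^sub>m 2)"
    have P: "P \<in> carrier_mat 2 2" using W by (simp add: P_def)
    define u :: complex where "u = of_real (1 / t)"
    have Pij: "P $$ (0,0) = u * (W $$ (0,0) + of_real d)" "P $$ (0,1) = u * W $$ (0,1)"
      "P $$ (1,0) = u * W $$ (1,0)" "P $$ (1,1) = u * (W $$ (1,1) + of_real d)"
      using W by (simp_all add: P_def u_def)
    \<comment> \<open>A Gram factor of \<open>P\<close>: two columns from the adjoint of
      \<open>V\<close> for \<open>W\<close>, and two from \<open>sqrt d\<close> times the identity,
      shifted by 2.\<close>
    define b where "b r c = of_real (sqrt (1/t)) *
      (if c < 2 then cnj (V $$ (c, r)) else if c = r + 2 then of_real (sqrt d) else 0 :: complex)" for r c :: nat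
    have st: "complex_of_real (sqrt (1/t)) * of_real (sqrt (1/t)) = of_real (1/t)"
      unfolding of_real_mult[symmetric] using tpos by simp
    have sd: "complex_of_real (sqrt d) * of_real (sqrt d) = of_real d"
      unfolding of_real_mult[symmetric] using nn by simp
    have "psd 2 P"
    proof (rule psd_gramI[OF P, where S = "{..<4}" and b = b])
      fix r s :: nat assume rs: "r < 2" "s < 2"
      have "(\<Sum>c<4. b r c * cnj (b s c)) = (complex_of_real (sqrt (1/t)) * of_real (sqrt (1/t))) *
        (cnj (V $$ (0, r)) * V $$ (0, s) + cnj (V $$ (1, r)) * V $$ (1, s)
          + (if r = s then complex_of_real (sqrt d) * of_real (sqrt d) else 0))"
        using rs by (auto simp: b_def numeral_eq_Suc less_Suc_eq algebra_simps One_nat_def)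
      also have "\<dots> = P $$ (r, s)"
        unfolding st sd using rs W gram_index[OF V rs, folded W_def] by (simp add: P_def)
      finally show "P $$ (r, s) = (\<Sum>c<4. b r c * cnj (b s c))" ..
    qed
    moreover have "P * P = W"
    proof -
      have tt: "of_real (1/t) * of_real (1/t) * (W $$ (0,0) + W $$ (1,1) + 2 * of_real d) = (1 :: complex)"
      proof -
        have "W $$ (0,0) + W $$ (1,1) + 2 * of_real d = of_real (t * t)"
          unfolding t2 using trW by simp
        then show ?thesis using tpos by simp
      qed
      have key: "u * u * z * (W $$ (0,0) + W $$ (1,1) + 2 * of_real d) = z" for z :: complex
        using arg_cong[OF tt, of "\<lambda>x. z * x"] unfolding u_def[symmetric] by (simp add: mult_ac)
      have dd: "W $$ (0,1) * W $$ (1,0) = W $$ (0,0) * W $$ (1,1) - of_real d * of_real d"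
        using dW by simp
      show ?thesis
      proof (rule eq_mat_2I)
        show "P * P \<in> carrier_mat 2 2" using P by simp
        note PP = mult_index_2[OF P P]
        have "(P * P) $$ (0,0) = u * u * ((W $$ (0,0) + of_real d) * (W $$ (0,0) + of_real d) + W $$ (0,1) * W $$ (1,0))"
          by (simp add: PP Pij u_def[symmetric]) (simp add: algebra_simps)
        also have "\<dots> = u * u * W $$ (0,0) * (W $$ (0,0) + W $$ (1,1) + 2 * of_real d)"
          unfolding dd by (simp add: algebra_simps)
        finally show "(P * P) $$ (0,0) = W $$ (0,0)" unfolding key .
        have "(P * P) $$ (1,1) = u * u * ((W $$ (1,1) + of_real d) * (W $$ (1,1) + of_real d) + W $$ (0,1) * W $$ (1,0))"
          by (simp add: PP Pij u_def[symmetric]) (simp add: algebra_simps)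
        also have "\<dots> = u * u * W $$ (1,1) * (W $$ (0,0) + W $$ (1,1) + 2 * of_real d)"
          unfolding dd by (simp add: algebra_simps)
        finally show "(P * P) $$ (1,1) = W $$ (1,1)" unfolding key .
        have "(P * P) $$ (0,1) = u * u * W $$ (0,1) * (W $$ (0,0) + W $$ (1,1) + 2 * of_real d)"
          by (simp add: PP Pij u_def[symmetric]) (simp add: algebra_simps)
        then show "(P * P) $$ (0,1) = W $$ (0,1)" unfolding key .
        have "(P * P) $$ (1,0) = u * u * W $$ (1,0) * (W $$ (0,0) + W $$ (1,1) + 2 * of_real d)"
          by (simp add: PP Pij u_def[symmetric]) (simp add: algebra_simps)
        then show "(P * P) $$ (1,0) = W $$ (1,0)" unfolding key .
      qed (rule W)
    qed
    ultimately show ?thesis unfolding W_def by blast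
  qed
qed

lemma trace_norm_eq:
  assumes V: "V \<in> carrier_mat 2 2"
  shows "trace_norm 2 V = sqrt (frob_sq V + 2 * cmod (det2 V))"
proof -
  have "\<exists>!P. psd 2 P \<and> P * P = mat_adjoint V * V"
    using psd_root_exists[OF V] psd_root_unique[OF V] by blast
  from theI'[OF this] have "psd 2 (psd_sqrt 2 (mat_adjoint V * V))"
    "psd_sqrt 2 (mat_adjoint V * V) * psd_sqrt 2 (mat_adjoint V * V) = mat_adjoint V * V"
    unfolding psd_sqrt_def by auto
  from psd_root_trace(1)[OF V this] show ?thesis by (simp add: trace_norm_def)
qed

lemma entry_le_trace_norm:
  assumes V: "V \<in> carrier_mat 2 2" and "i < 2" "j < 2"
  shows "cmod (V $$ (i, j)) \<le> trace_norm 2 V"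
proof -
  have "(cmod (V $$ (i, j)))\<^sup>2 \<le> frob_sq V"
    using assms(2,3) by (auto simp: frob_sq_def nat_less_2_iff)
  then have "(cmod (V $$ (i, j)))\<^sup>2 \<le> frob_sq V + 2 * cmod (det2 V)" by (simp add: add_increasing2)
  then show ?thesis unfolding trace_norm_eq[OF V] by (rule real_le_rsqrt)
qed

lemma trace_norm_nonneg: "V \<in> carrier_mat 2 2 \<Longrightarrow> trace_norm 2 V \<ge> 0"
  by (rule order_trans[OF norm_ge_zero entry_le_trace_norm[of V 0 0]]) auto

text \<open>The squared norm is at most \<open>(4 + 2 * 2) * w\<^sup>2\<close>, and 8 is rounded up
  to the square of 3.\<close>

lemma trace_norm_le:
  assumes V: "V \<in> carrier_mat 2 2" and w: "\<And>i j. i < 2 \<Longrightarrow> j < 2 \<Longrightarrow> cmod (V $$ (i, j)) \<le> w"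
  shows "trace_norm 2 V \<le> 3 * w"
proof -
  have w0: "w \<ge> 0" using w[of 0 0] norm_ge_zero[of "V $$ (0,0)"] by linarith
  have sq: "(cmod (V $$ (i, j)))\<^sup>2 \<le> w\<^sup>2" if "i < 2" "j < 2" for i j
    using w[OF that] by (intro power_mono) auto
  have "frob_sq V \<le> 4 * w\<^sup>2"
    using sq[of 0 0] sq[of 0 1] sq[of 1 0] sq[of 1 1] by (simp add: frob_sq_def)
  moreover have "cmod (det2 V) \<le> 2 * w\<^sup>2"
  proof -
    have "cmod (V $$ (i, j)) * cmod (V $$ (k, l)) \<le> w * w" if "i < 2" "j < 2" "k < 2" "l < 2" for i j k l
      using w that w0 by (intro mult_mono) auto
    from this[of 0 0 1 1] this[of 0 1 1 0] show ?thesis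
      using norm_triangle_ineq4[of "V $$ (0,0) * V $$ (1,1)" "V $$ (0,1) * V $$ (1,0)"]
      by (simp add: det2_def norm_mult power2_eq_square)
  qed
  moreover have "(3 * w)\<^sup>2 = 9 * w\<^sup>2" by (simp add: power_mult_distrib)
  moreover note zero_le_power2[of w]
  ultimately have "frob_sq V + 2 * cmod (det2 V) \<le> (3 * w)\<^sup>2" by linarith
  then show ?thesis unfolding trace_norm_eq[OF V] using w0 by (intro real_le_lsqrt) auto
qed


section \<open>Polynomial functions of the Kraus entries\<close>

text \<open>Existence of an expression is hidden in a predicate on functions, so that polynomiality
  of iterated Kraus maps follows from closure rules.\<close>

definition polynomial_on :: "'v set \<Rightarrow> (('v \<Rightarrow> real) \<Rightarrow> real) \<Rightarrow> bool" where
  "polynomial_on I f \<longleftrightarrow> (\<exists>p. pvars p \<subseteq> I \<and> (\<forall>x. peval id x p = f x))"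

lemma polynomial_on_const: "polynomial_on I (\<lambda>_. c)"
  unfolding polynomial_on_def by (intro exI[of _ "Const c"]) simp

lemma polynomial_on_var: "i \<in> I \<Longrightarrow> polynomial_on I (\<lambda>x. x i)"
  unfolding polynomial_on_def by (intro exI[of _ "Var i"]) simp

lemma polynomial_on_add: "polynomial_on I f \<Longrightarrow> polynomial_on I g \<Longrightarrow> polynomial_on I (\<lambda>x. f x + g x)"
  unfolding polynomial_on_def
proof (elim exE conjE)
  fix p q assume "pvars p \<subseteq> I" "\<forall>x. peval id x p = f x" "pvars q \<subseteq> I" "\<forall>x. peval id x q = g x"
  then show "\<exists>p. pvars p \<subseteq> I \<and> (\<forall>x. peval id x p = f x + g x)" by (intro exI[of _ "Add p q"]) simp
qed

lemma polynomial_on_mult: "polynomial_on I f \<Longrightarrow> polynomial_on I g \<Longrightarrow> polynomial_on I (\<lambda>x. f x * g x)"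
  unfolding polynomial_on_def
proof (elim exE conjE)
  fix p q assume "pvars p \<subseteq> I" "\<forall>x. peval id x p = f x" "pvars q \<subseteq> I" "\<forall>x. peval id x q = g x"
  then show "\<exists>p. pvars p \<subseteq> I \<and> (\<forall>x. peval id x p = f x * g x)" by (intro exI[of _ "Mult p q"]) simp
qed

lemma polynomial_on_uminus: "polynomial_on I f \<Longrightarrow> polynomial_on I (\<lambda>x. - f x)"
  using polynomial_on_mult[OF polynomial_on_const[of I "- 1"]] by fastforce

lemma polynomial_on_diff: "polynomial_on I f \<Longrightarrow> polynomial_on I g \<Longrightarrow> polynomial_on I (\<lambda>x. f x - g x)"
  using polynomial_on_add[OF _ polynomial_on_uminus, of I f g] by simp

corollary Lojasiewicz_functions:
  fixes Fs :: "(('v \<Rightarrow> real) \<Rightarrow> real) set"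
  assumes "finite I" "finite Fs" and poly: "\<And>f. f \<in> Fs \<Longrightarrow> polynomial_on I f"
    and zero: "\<And>f. f \<in> Fs \<Longrightarrow> f z = 0"
  shows "\<exists>k\<ge>1. \<exists>C>0. \<forall>x e. e \<ge> 0 \<longrightarrow> (\<forall>i\<in>I. \<bar>x i\<bar> \<le> B) \<longrightarrow> (\<forall>f\<in>Fs. \<bar>f x\<bar> \<le> e) \<longrightarrow>
    (\<exists>y. (\<forall>f\<in>Fs. f y = 0) \<and> (\<forall>i\<in>I. \<bar>x i - y i\<bar> \<le> C * e powr (1 / real k)))"
proof -
  have "\<forall>f\<in>Fs. \<exists>p. pvars p \<subseteq> I \<and> (\<forall>x. peval id x p = f x)"
    using poly unfolding polynomial_on_def by blast
  from bchoice[OF this] obtain P where P: "\<forall>f\<in>Fs. pvars (P f) \<subseteq> I \<and> (\<forall>x. peval id x (P f) = f x)"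
    by (rule exE)
  have "\<exists>k\<ge>1. \<exists>C>0. \<forall>x e. e \<ge> 0 \<longrightarrow> (\<forall>i\<in>I. \<bar>x i\<bar> \<le> B) \<longrightarrow> (\<forall>p\<in>P ` Fs. \<bar>peval id x p\<bar> \<le> e) \<longrightarrow>
    (\<exists>y. (\<forall>p\<in>P ` Fs. peval id y p = 0) \<and> (\<forall>i\<in>I. \<bar>x i - y i\<bar> \<le> C * e powr (1 / real k)))"
    by (rule Lojasiewicz[where z = z]) (use assms(1,2) P zero in auto)
  moreover have "(\<forall>p\<in>P ` Fs. \<bar>peval id x p\<bar> \<le> e) \<longleftrightarrow> (\<forall>f\<in>Fs. \<bar>f x\<bar> \<le> e)"
    "(\<forall>p\<in>P ` Fs. peval id x p = 0) \<longleftrightarrow> (\<forall>f\<in>Fs. f x = 0)" for x e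
    using P by auto
  ultimately show ?thesis by simp
qed

section \<open>Complex polynomial functions of real coordinates, applied to Kraus entries\<close>

definition cpolynomial_on :: "'v set \<Rightarrow> (('v \<Rightarrow> real) \<Rightarrow> complex) \<Rightarrow> bool" where
  "cpolynomial_on I f \<longleftrightarrow> polynomial_on I (\<lambda>x. Re (f x)) \<and> polynomial_on I (\<lambda>x. Im (f x))"

lemma cpolynomial_on_const: "cpolynomial_on I (\<lambda>_. c)"
  by (simp add: cpolynomial_on_def polynomial_on_const)

lemma cpolynomial_on_add:
  "cpolynomial_on I f \<Longrightarrow> cpolynomial_on I g \<Longrightarrow> cpolynomial_on I (\<lambda>x. f x + g x)"
  by (simp add: cpolynomial_on_def polynomial_on_add)

lemma cpolynomial_on_diff:
  "cpolynomial_on I f \<Longrightarrow> cpolynomial_on I g \<Longrightarrow> cpolynomial_on I (\<lambda>x. f x - g x)"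
  by (simp add: cpolynomial_on_def polynomial_on_diff)

lemma cpolynomial_on_mult:
  "cpolynomial_on I f \<Longrightarrow> cpolynomial_on I g \<Longrightarrow> cpolynomial_on I (\<lambda>x. f x * g x)"
  by (simp add: cpolynomial_on_def polynomial_on_add polynomial_on_diff polynomial_on_mult)

lemma cpolynomial_on_cnj: "cpolynomial_on I f \<Longrightarrow> cpolynomial_on I (\<lambda>x. cnj (f x))"
  by (simp add: cpolynomial_on_def polynomial_on_uminus)

lemma cpolynomial_on_sum:
  "(\<And>j. j \<in> J \<Longrightarrow> cpolynomial_on I (\<lambda>x. f x j)) \<Longrightarrow> cpolynomial_on I (\<lambda>x. \<Sum>j\<in>J. f x j)"
  by (induction J rule: infinite_finite_induct) (simp_all add: cpolynomial_on_const cpolynomial_on_add)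

type_synonym kraus_index = "nat \<times> nat \<times> nat \<times> bool"

definition kraus_vars :: "kraus_index set" where
  "kraus_vars = {..<4} \<times> {..<2} \<times> {..<2} \<times> UNIV"

definition kraus_of :: "(kraus_index \<Rightarrow> real) \<Rightarrow> nat \<Rightarrow> nat \<Rightarrow> nat \<Rightarrow> complex" where
  "kraus_of x l i a = Complex (x (l, i, a, False)) (x (l, i, a, True))"

definition kraus_coords :: "(nat \<Rightarrow> nat \<Rightarrow> nat \<Rightarrow> complex) \<Rightarrow> kraus_index \<Rightarrow> real" where
  "kraus_coords A = (\<lambda>(l, i, a, c). if c then Im (A l i a) else Re (A l i a))"

lemma kraus_of_coords: "kraus_of (kraus_coords A) = A"
  by (intro ext) (simp add: kraus_of_def kraus_coords_def)

lemma finite_kraus_vars: "finite kraus_vars"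
  by (simp add: kraus_vars_def)

lemma cpolynomial_on_kraus_of:
  "l < 4 \<Longrightarrow> i < 2 \<Longrightarrow> a < 2 \<Longrightarrow> cpolynomial_on kraus_vars (\<lambda>x. kraus_of x l i a)"
  by (simp add: cpolynomial_on_def kraus_of_def kraus_vars_def polynomial_on_var)

lemma cpolynomial_on_kraus_defect:
  "a < 2 \<Longrightarrow> b < 2 \<Longrightarrow> cpolynomial_on kraus_vars (\<lambda>x. kraus_defect (kraus_of x) a b)"
  unfolding kraus_defect_def
  by (intro cpolynomial_on_diff cpolynomial_on_sum cpolynomial_on_mult cpolynomial_on_cnj
      cpolynomial_on_const cpolynomial_on_kraus_of) auto

lemma cpolynomial_on_kraus_map_funpow:
  "i < 2 \<Longrightarrow> j < 2 \<Longrightarrow> cpolynomial_on kraus_vars (\<lambda>x. (kraus_map (kraus_of x) ^^ k) X $$ (i, j))"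
proof (induction k arbitrary: i j)
  case 0
  then show ?case by (simp add: cpolynomial_on_const)
next
  case (Suc k)
  have "(kraus_map (kraus_of x) ^^ Suc k) X $$ (i, j) = (\<Sum>l<4. \<Sum>a<2. \<Sum>b<2.
      kraus_of x l i a * (kraus_map (kraus_of x) ^^ k) X $$ (a, b) * cnj (kraus_of x l j b))" for x
    using Suc.prems by (simp add: kraus_map_def[of _ "(kraus_map _ ^^ k) X"])
  then show ?case using Suc
    by (simp only:) (intro cpolynomial_on_sum cpolynomial_on_mult cpolynomial_on_cnj
      cpolynomial_on_kraus_of, auto)
qed

lemma Pr0_eq: "\<rho> \<in> carrier_mat 2 2 \<Longrightarrow> Pr0 \<rho> = Re (\<rho> $$ (0, 0))"
  by (simp add: Pr0_def scalar_prod_def numeral_2_eq_2)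

lemma ket_bra_carrier: "ket_bra b \<in> carrier_mat 2 2"
  by (simp add: ket_bra_def)


section \<open>Distance of operations in Kraus form\<close>

text \<open>Each entry of the difference has 16 summands, each at most \<open>2 * \<delta>\<close>
  by changing one factor at a time, all entries of \<open>A\<close>, \<open>A'\<close> and
  \<open>X\<close> being at most 1. \<open>trace_norm_le\<close> contributes the factor 3.\<close>

lemma kraus_map_lipschitz:
  assumes A: "trace_preserving A" and A': "trace_preserving A'" and X: "X \<in> carrier_mat 2 2"
    and X1: "trace_norm 2 X = 1"
    and \<delta>: "\<And>l i a. l < 4 \<Longrightarrow> i < 2 \<Longrightarrow> a < 2 \<Longrightarrow> cmod (A l i a - A' l i a) \<le> \<delta>"
  shows "trace_norm 2 (kraus_map A X - kraus_map A' X) \<le> 96 * \<delta>"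
proof -
  have "cmod ((kraus_map A X - kraus_map A' X) $$ (i, j)) \<le> 32 * \<delta>" if ij: "i < 2" "j < 2" for i j
  proof -
    have b: "cmod (A l i a * X $$ (a, b) * cnj (A l j b) - A' l i a * X $$ (a, b) * cnj (A' l j b)) \<le> 2 * \<delta>"
      if "l < 4" "a < 2" "b < 2" for l a b
    proof -
      have eq: "A l i a * X $$ (a, b) * cnj (A l j b) - A' l i a * X $$ (a, b) * cnj (A' l j b)
        = (A l i a - A' l i a) * X $$ (a, b) * cnj (A l j b) + A' l i a * X $$ (a, b) * cnj (A l j b - A' l j b)"
        by (simp add: algebra_simps)
      have "cmod ((A l i a - A' l i a) * X $$ (a, b) * cnj (A l j b) + A' l i a * X $$ (a, b) * cnj (A l j b - A' l j b))
        \<le> cmod (A l i a - A' l i a) * cmod (X $$ (a, b)) * cmod (A l j b)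
          + cmod (A' l i a) * cmod (X $$ (a, b)) * cmod (A l j b - A' l j b)"
        by (rule order_trans[OF norm_triangle_ineq]) (simp add: norm_mult flip: complex_cnj_diff)
      also have "\<dots> \<le> \<delta> * 1 * 1 + 1 * 1 * \<delta>"
      proof -
        have "cmod (X $$ (a, b)) \<le> 1" using entry_le_trace_norm[OF X that(2,3)] X1 by simp
        moreover have "cmod (A l j b) \<le> 1" "cmod (A' l i a) \<le> 1"
          using trace_preserving_bound A A' ij that by auto
        moreover have "\<delta> \<ge> 0" using order_trans[OF norm_ge_zero \<delta>[of 0 0 0]] by simp
        ultimately show ?thesis using \<delta> ij that by (intro add_mono mult_mono) auto
      qed
      finally show ?thesis unfolding eq by simp
    qed
    have eq: "(kraus_map A X - kraus_map A' X) $$ (i, j) = (\<Sum>l<4. \<Sum>a<2. \<Sum>b<2.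
        A l i a * X $$ (a, b) * cnj (A l j b) - A' l i a * X $$ (a, b) * cnj (A' l j b))"
      using ij by (simp add: kraus_map_def sum_subtractf)
    have "cmod (\<Sum>l<4. \<Sum>a<2. \<Sum>b<2.
        A l i a * X $$ (a, b) * cnj (A l j b) - A' l i a * X $$ (a, b) * cnj (A' l j b))
      \<le> (\<Sum>l<(4::nat). \<Sum>a<(2::nat). \<Sum>b<(2::nat). 2 * \<delta>)"
      by (intro sum_norm_le b) auto
    then show ?thesis unfolding eq by simp
  qed
  then show ?thesis
    using trace_norm_le[of "kraus_map A X - kraus_map A' X" "32 * \<delta>"] kraus_map_carrier
    by (simp add: minus_carrier_mat)
qed

lemma trace_norm_mat_unit: "trace_norm 2 (mat_unit 0 0) = 1"
  by (simp add: trace_norm_eq mat_unit_carrier frob_sq_def det2_def) (simp add: mat_unit_def)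

lemma op_dist_kraus:
  assumes G: "\<And>X. X \<in> carrier_mat 2 2 \<Longrightarrow> G X = kraus_map A X"
    and H: "\<And>X. X \<in> carrier_mat 2 2 \<Longrightarrow> H X = kraus_map A' X"
    and A: "trace_preserving A" and A': "trace_preserving A'"
    and \<delta>: "\<And>l i a. l < 4 \<Longrightarrow> i < 2 \<Longrightarrow> a < 2 \<Longrightarrow> cmod (A l i a - A' l i a) \<le> \<delta>"
  shows "0 \<le> op_dist G H" "op_dist G H \<le> 96 * \<delta>"
proof -
  define S where "S = {trace_norm 2 (G V - H V) | V. V \<in> carrier_mat 2 2 \<and> trace_norm 2 V = 1}"
  have dist: "op_dist G H = Sup S" by (simp add: op_dist_def op_norm_def S_def)
  have le: "s \<le> 96 * \<delta>" if "s \<in> S" for s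
    using that kraus_map_lipschitz[OF A A' _ _ \<delta>] G H by (auto simp: S_def)
  \<comment> \<open>The supremum is a supremum of reals, so the set must be seen to be nonempty as
    well as bounded.\<close>
  have mem: "trace_norm 2 (G (mat_unit 0 0) - H (mat_unit 0 0)) \<in> S"
    using mat_unit_carrier trace_norm_mat_unit by (auto simp: S_def)
  show "op_dist G H \<le> 96 * \<delta>" unfolding dist using mem le by (intro cSup_least) auto
  have "0 \<le> trace_norm 2 (G (mat_unit 0 0) - H (mat_unit 0 0))"
    by (rule trace_norm_nonneg) (simp add: G H mat_unit_carrier minus_carrier_mat kraus_map_carrier)
  also have "\<dots> \<le> op_dist G H"
    unfolding dist using mem le by (intro cSup_upper) (auto simp: bdd_above_def)
  finally show "0 \<le> op_dist G H" .
qed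

lemma op_dist_nonneg:
  assumes "cpso 2 G" "cpso 2 H"
  shows "0 \<le> op_dist G H"
proof -
  obtain A where A: "trace_preserving A" "\<forall>X\<in>carrier_mat 2 2. G X = kraus_map A X"
    using cpso_kraus[OF assms(1)] by blast
  obtain A' where A': "trace_preserving A'" "\<forall>X\<in>carrier_mat 2 2. H X = kraus_map A' X"
    using cpso_kraus[OF assms(2)] by blast
  \<comment> \<open>A crude bound, needed only to make the set under the supremum bounded.
    Nonnegativity of distances in turn bounds the infimum in \<open>op_setdist\<close> from
    below.\<close>
  have "cmod (A l i a - A' l i a) \<le> 2" if "l < 4" "i < 2" "a < 2" for l i a
    using norm_triangle_ineq4[of "A l i a" "A' l i a"]
      trace_preserving_bound[OF A(1) that] trace_preserving_bound[OF A'(1) that] by linarith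
  then show ?thesis using A A' by (intro op_dist_kraus(1)[of G A H A' 2]) auto
qed

lemma op_setdist_le:
  assumes "cpso 2 G" "H \<in> solutions E"
  shows "op_setdist G (solutions E) \<le> op_dist G H"
  unfolding op_setdist_def
proof (rule cInf_lower)
  show "bdd_below {op_dist G H |H. H \<in> solutions E}"
    using op_dist_nonneg[OF assms(1)] by (auto simp: bdd_below_def solutions_def)
qed (use assms in auto)

lemma eps_satisfies_kraus:
  assumes "\<And>X. X \<in> carrier_mat 2 2 \<Longrightarrow> G X = kraus_map A X"
  shows "eps_satisfies \<epsilon> G E \<longleftrightarrow>
    (\<forall>e\<in>E. \<bar>Pr0 ((kraus_map A ^^ eq_power e) (ket_bra (eq_input e))) - eq_prob e\<bar> \<le> \<epsilon>)"
  unfolding eps_satisfies_def using funpow_kraus_map(1)[OF assms ket_bra_carrier] by simp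

theorem theorem4:
  fixes E :: "exp_eq set"
  assumes "finite E"
    and "\<forall>e\<in>E. experimental_equation e"
    and "satisfiable E"
  shows "\<exists>k::nat. k \<ge> 1 \<and> (\<exists>C::real. C > 0 \<and>
           (\<forall>\<epsilon>::real. \<epsilon> \<ge> 0 \<longrightarrow> robust \<epsilon> (C * \<epsilon> powr (1 / real k)) E))"
proof -
  define defect where "defect = (\<lambda>(a, b, c) x. if c then Im (kraus_defect (kraus_of x) a b)
    else Re (kraus_defect (kraus_of x) a b))"
  define err where "err e x = Pr0 ((kraus_map (kraus_of x) ^^ eq_power e) (ket_bra (eq_input e))) - eq_prob e"
    for e x
  \<comment> \<open>The trace conditions join the experimental equations. They hold exactly at the
    Kraus coordinates of a given CPSO, so its total error is that of the experiment, and a common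
    zero is again a CPSO.\<close>
  define Fs where "Fs = defect ` ({..<2} \<times> {..<2} \<times> UNIV) \<union> err ` E"
  have tp: "trace_preserving (kraus_of x) \<longleftrightarrow> (\<forall>f\<in>defect ` ({..<2} \<times> {..<2} \<times> UNIV). f x = 0)" for x
    by (auto simp: trace_preserving_def defect_def complex_eq_iff)
  have poly: "polynomial_on kraus_vars f" if "f \<in> Fs" for f
  proof -
    have "polynomial_on kraus_vars (defect (a, b, c))" if "a < 2" "b < 2" for a b c
      using cpolynomial_on_kraus_defect[OF that] by (cases c) (simp_all add: defect_def cpolynomial_on_def)
    moreover have "polynomial_on kraus_vars (err e)" for e
    proof -
      have "err e = (\<lambda>x. Re ((kraus_map (kraus_of x) ^^ eq_power e) (ket_bra (eq_input e)) $$ (0, 0)) - eq_prob e)"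
        by (intro ext) (simp add: err_def Pr0_eq funpow_kraus_map(2)[OF refl ket_bra_carrier])
      then show ?thesis using cpolynomial_on_kraus_map_funpow[of 0 0]
        by (auto simp: cpolynomial_on_def intro!: polynomial_on_diff polynomial_on_const)
    qed
    ultimately show ?thesis using that by (auto simp: Fs_def)
  qed
  obtain G0 where G0: "cpso 2 G0" "eps_satisfies 0 G0 E" using assms(3) unfolding satisfiable_def by blast
  obtain A0 where A0: "trace_preserving A0" "\<forall>X\<in>carrier_mat 2 2. G0 X = kraus_map A0 X"
    using cpso_kraus[OF G0(1)] by blast
  have zero: "f (kraus_coords A0) = 0" if "f \<in> Fs" for f
    using that A0(1) tp[of "kraus_coords A0"] G0(2) eps_satisfies_kraus[of G0 A0 0 E] A0(2)
    by (auto simp: Fs_def kraus_of_coords err_def)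
  have "finite Fs" using assms(1) by (simp add: Fs_def)
  then have "\<exists>k\<ge>1. \<exists>C>0. \<forall>x e. e \<ge> 0 \<longrightarrow> (\<forall>i\<in>kraus_vars. \<bar>x i\<bar> \<le> 1) \<longrightarrow>
      (\<forall>f\<in>Fs. \<bar>f x\<bar> \<le> e) \<longrightarrow>
      (\<exists>y. (\<forall>f\<in>Fs. f y = 0) \<and> (\<forall>i\<in>kraus_vars. \<bar>x i - y i\<bar> \<le> C * e powr (1 / real k)))"
    by (rule Lojasiewicz_functions[where z = "kraus_coords A0", OF finite_kraus_vars])
      (fact poly zero)+
  then obtain k C where k: "k \<ge> 1" and C: "C > 0" and near: "\<forall>x e. e \<ge> 0 \<longrightarrow> (\<forall>i\<in>kraus_vars. \<bar>x i\<bar> \<le> 1) \<longrightarrow>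
      (\<forall>f\<in>Fs. \<bar>f x\<bar> \<le> e) \<longrightarrow>
      (\<exists>y. (\<forall>f\<in>Fs. f y = 0) \<and> (\<forall>i\<in>kraus_vars. \<bar>x i - y i\<bar> \<le> C * e powr (1 / real k)))"
    by (elim exE conjE)
  \<comment> \<open>192 is 96 from \<open>op_dist_kraus\<close> times 2 from bounding a modulus by
    real and imaginary parts.\<close>
  have "robust \<epsilon> (192 * C * \<epsilon> powr (1 / real k)) E" if \<epsilon>: "\<epsilon> \<ge> 0" for \<epsilon>
    unfolding robust_def
  proof (intro allI impI, elim conjE)
    fix G assume G: "cpso 2 G" and sat: "eps_satisfies \<epsilon> G E"
    obtain A where A: "trace_preserving A" "\<forall>X\<in>carrier_mat 2 2. G X = kraus_map A X"
      using cpso_kraus[OF G] by blast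
    define x where "x = kraus_coords A"
    have x: "kraus_of x = A" by (simp add: x_def kraus_of_coords)
    have "\<bar>x i\<bar> \<le> 1" if i: "i \<in> kraus_vars" for i
    proof -
      obtain l j a c where i': "i = (l, j, a, c)" by (metis prod_cases4)
      then have "cmod (A l j a) \<le> 1" using i by (intro trace_preserving_bound[OF A(1)]) (auto simp: kraus_vars_def)
      then show ?thesis
        using abs_Re_le_cmod[of "A l j a"] abs_Im_le_cmod[of "A l j a"]
        by (simp add: x_def kraus_coords_def i')
    qed
    moreover have "\<bar>f x\<bar> \<le> \<epsilon>" if "f \<in> Fs" for f
      using that A(1) tp[of x] \<epsilon> sat eps_satisfies_kraus[of G A \<epsilon> E] A(2)
      by (auto simp: Fs_def x err_def)
    ultimately obtain y where y0: "\<forall>f\<in>Fs. f y = 0"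
      and y: "\<forall>i\<in>kraus_vars. \<bar>x i - y i\<bar> \<le> C * \<epsilon> powr (1 / real k)"
      using near[rule_format, OF \<epsilon>, of x] by blast
    define H where "H = kraus_map (kraus_of y)"
    have ty: "trace_preserving (kraus_of y)" unfolding tp using y0 by (auto simp: Fs_def)
    have "err e y = 0" if "e \<in> E" for e using y0 that by (auto simp: Fs_def)
    then have "eps_satisfies 0 H E"
      by (subst eps_satisfies_kraus[of H "kraus_of y"]) (simp_all add: H_def err_def)
    then have "H \<in> solutions E" using cpso_kraus_map[OF ty] by (simp add: solutions_def H_def)
    then have "op_setdist G (solutions E) \<le> op_dist G H" by (rule op_setdist_le[OF G])
    also have "\<dots> \<le> 96 * (2 * (C * \<epsilon> powr (1 / real k)))"
    proof (rule op_dist_kraus(2)[of G A H "kraus_of y"])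
      fix l i a :: nat assume "l < 4" "i < 2" "a < 2"
      then have "(l, i, a, c) \<in> kraus_vars" for c by (simp add: kraus_vars_def)
      then have yc: "\<bar>x (l, i, a, c) - y (l, i, a, c)\<bar> \<le> C * \<epsilon> powr (1 / real k)" for c using y by blast
      have "cmod (A l i a - kraus_of y l i a) \<le> \<bar>x (l, i, a, False) - y (l, i, a, False)\<bar> + \<bar>x (l, i, a, True) - y (l, i, a, True)\<bar>"
        using cmod_le[of "A l i a - kraus_of y l i a"] unfolding x[symmetric] by (simp add: kraus_of_def)
      then show "cmod (A l i a - kraus_of y l i a) \<le> 2 * (C * \<epsilon> powr (1 / real k))"
        using yc[of False] yc[of True] by linarith
    qed (use A ty in \<open>auto simp: H_def\<close>)
    finally show "op_setdist G (solutions E) \<le> 192 * C * \<epsilon> powr (1 / real k)" by simp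
  qed
  then show ?thesis using k C by (intro exI[of _ k] conjI exI[of _ "192 * C"]) auto
qed

end
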